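(* Let $p$ be an integer which is either an odd prime or composite. Let $L$ be a non-split link which admits non-trivial $p$-colorings. 1. If $L$ admits a minimal non-trivial $p$-coloring with a crossing at which the over-arc has color $1$ and the two under-arcs have colors $0$ and $2$ (mod $p$), then $$\mathrm{Spec}_p L = \{ \mathrm{mincol}_p L,\ 1+\mathrm{mincol}_p L,\ 2+\mathrm{mincol}_p L,\ \dots,\ \mathrm{maxcol}_p L \}.$$ 2. If $L$ admits a minimal non-trivial $p$-coloring with a crossing at which the over-arc has color $b$ and the two under-arcs have colors $a$ and $2b-a$ (mod $p$), and $b-a$ is invertible mod $p$, then the same equality $$\mathrm{Spec}_p L = \{ \mathrm{mincol}_p L,\ 1+\mathrm{mincol}_p L,\ 2+\mathrm{mincol}_p L,\ \dots,\ \mathrm{maxcol}_p L \}$$ holds.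
   Context: Links are classical links in $3$-space. A split link is a link which can be made (by isotopy) to be contained in two disjoint balls in $3$-space, with part of the link in each ball; a non-split link is a link which is not split. For an integer $p>1$ and a diagram $D$ of a link $L$, a $p$-coloring of $D$ is an assignment of integers modulo $p$ (called colors) to the arcs of $D$ such that at each crossing, twice the color of the over-arc equals the sum of the colors of the two under-arcs, modulo $p$. A $p$-coloring is trivial if all arcs of the diagram receive the same color, and non-trivial if it uses more than one color. Whether a link admits non-trivial $p$-colorings does not depend on the diagram. Suppose $L$ admits non-trivial $p$-colorings. $\mathrm{mincol}_p L$ (respectively $\mathrm{maxcol}_p L$) is the minimum (respectively maximum) number of distinct colors used in a non-trivial $p$-coloring of a diagram of $L$, taken over all diagrams of $L$ and all their non-trivial $p$-colorings. A minimal non-trivial $p$-coloring of $L$ is a non-trivial $p$-coloring of some diagram of $L$ using exactly $\mathrm{mincol}_p L$ colors. The spectrum of $L$ mod $p$ is $\mathrm{Spec}_p L := \{ n\in \mathbf{Z}^+ \mid \text{there is a diagram } D \text{ of } L \text{ with a non-trivial } p\text{-coloring which uses (exactly) } n \text{ colors}\}$. *)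

theory Defs
  imports "HOL-Analysis.Analysis" "HOL-Number_Theory.Cong"
begin

section \<open>Links in 3-space\<close>

definition ambient_isotopic :: "(real^3) set \<Rightarrow> (real^3) set \<Rightarrow> bool" where
  "ambient_isotopic K L \<longleftrightarrow>
     (\<exists>f. homotopic_with_canon (\<lambda>g. \<exists>g'. homeomorphism UNIV UNIV g g') UNIV UNIV id f \<and>
          f ` K = L)"

definition polygonal :: "(real^3) set \<Rightarrow> bool" where
  "polygonal K \<longleftrightarrow> (\<exists>E. finite E \<and> K = (\<Union>(a, b)\<in>E. closed_segment a b))"

text \<open>The last conjunct is tameness, which excludes wild knots.\<close>

definition is_link :: "(real^3) set \<Rightarrow> bool" where
  "is_link L \<longleftrightarrow>
     L \<noteq> {} \<and> finite (components L) \<and>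
     (\<forall>C\<in>components L. C homeomorphic sphere (0::complex) 1) \<and>
     (\<exists>K. polygonal K \<and> ambient_isotopic K L)"

definition split_link :: "(real^3) set \<Rightarrow> bool" where
  "split_link L \<longleftrightarrow>
     is_link L \<and>
     (\<exists>L' a r b s. ambient_isotopic L L' \<and> cball a r \<inter> cball b s = {} \<and>
        L' \<subseteq> cball a r \<union> cball b s \<and> L' \<inter> cball a r \<noteq> {} \<and> L' \<inter> cball b s \<noteq> {})"

section \<open>Diagrams\<close>

text \<open>
  A diagram is represented by a polygonal link in regular position with respect to the vertical
  projection: the planar picture is its projection, and the heights at the double points give
  the over/under information.  A point of the planar picture thus corresponds to one point of
  the link, or to two at a crossing, and arcs can be taken as subsets of the link itself.
\<close>

definition proj :: "real^3 \<Rightarrow> real \<times> real" where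
  "proj x = (x $ 1, x $ 2)"

text \<open>\<open>crossing D x y\<close>: at a crossing, \<open>x\<close> lies on the over-strand and \<open>y\<close> on the under-strand.\<close>

definition crossing :: "(real^3) set \<Rightarrow> real^3 \<Rightarrow> real^3 \<Rightarrow> bool" where
  "crossing D x y \<longleftrightarrow> x \<in> D \<and> y \<in> D \<and> proj x = proj y \<and> y $ 3 < x $ 3"

definition straight_at :: "(real^3) set \<Rightarrow> real^3 \<Rightarrow> real^3 \<Rightarrow> bool" where
  "straight_at D x u \<longleftrightarrow> (\<exists>e>0. D \<inter> ball x e = range (\<lambda>t. x + t *\<^sub>R u) \<inter> ball x e)"

text \<open>
  Regular position: only finitely many multiple points, all of them double points where two
  edges cross transversally.  In particular no vertex lies over or under another point.
\<close>

definition diagram :: "(real^3) set \<Rightarrow> bool" where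
  "diagram D \<longleftrightarrow>
     is_link D \<and> polygonal D \<and>
     finite {(x, y). crossing D x y} \<and>
     (\<forall>x\<in>D. \<forall>y\<in>D. \<forall>z\<in>D. proj x = proj y \<and> proj y = proj z \<longrightarrow> x = y \<or> y = z \<or> x = z) \<and>
     (\<forall>x y. crossing D x y \<longrightarrow>
        (\<exists>u v. straight_at D x u \<and> straight_at D y v \<and> u $ 1 * v $ 2 \<noteq> u $ 2 * v $ 1))"

definition diagram_of :: "(real^3) set \<Rightarrow> (real^3) set \<Rightarrow> bool" where
  "diagram_of D L \<longleftrightarrow> diagram D \<and> ambient_isotopic L D"

definition under_points :: "(real^3) set \<Rightarrow> (real^3) set" where
  "under_points D = {y. \<exists>x. crossing D x y}"

definition arcs :: "(real^3) set \<Rightarrow> (real^3) set set" where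
  "arcs D = components (D - under_points D)"

text \<open>
  At some crossing of \<open>D\<close> the over-arc is \<open>A\<close> and the under-arcs are \<open>B\<close> and \<open>C\<close> (in either
  order).  The under-arcs are those having the under-point as an end point; if a single arc
  arrives at the under-point from both sides, then \<open>B = C\<close>.
\<close>

definition crossing_arcs ::
    "(real^3) set \<Rightarrow> (real^3) set \<Rightarrow> (real^3) set \<Rightarrow> (real^3) set \<Rightarrow> bool" where
  "crossing_arcs D A B C \<longleftrightarrow>
     (\<exists>x y. crossing D x y \<and> A \<in> arcs D \<and> x \<in> A \<and> {U \<in> arcs D. y \<in> closure U} = {B, C})"

section \<open>Colorings\<close>

text \<open>Colors are the residues \<open>0, \<dots>, p - 1\<close>; values of \<open>c\<close> outside \<open>arcs D\<close> are irrelevant.\<close>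

definition coloring :: "nat \<Rightarrow> (real^3) set \<Rightarrow> ((real^3) set \<Rightarrow> int) \<Rightarrow> bool" where
  "coloring p D c \<longleftrightarrow>
     c ` arcs D \<subseteq> {0..<int p} \<and>
     (\<forall>A B C. crossing_arcs D A B C \<longrightarrow> [2 * c A = c B + c C] (mod int p))"

definition num_colors :: "(real^3) set \<Rightarrow> ((real^3) set \<Rightarrow> int) \<Rightarrow> nat" where
  "num_colors D c = card (c ` arcs D)"

definition nontrivial_coloring_of ::
    "nat \<Rightarrow> (real^3) set \<Rightarrow> (real^3) set \<Rightarrow> ((real^3) set \<Rightarrow> int) \<Rightarrow> bool" where
  "nontrivial_coloring_of p L D c \<longleftrightarrow> diagram_of D L \<and> coloring p D c \<and> num_colors D c > 1"

definition admits_nontrivial_colorings :: "nat \<Rightarrow> (real^3) set \<Rightarrow> bool" where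
  "admits_nontrivial_colorings p L \<longleftrightarrow> (\<exists>D c. nontrivial_coloring_of p L D c)"

definition mincol :: "nat \<Rightarrow> (real^3) set \<Rightarrow> nat" where
  "mincol p L = (LEAST n. \<exists>D c. nontrivial_coloring_of p L D c \<and> num_colors D c = n)"

definition maxcol :: "nat \<Rightarrow> (real^3) set \<Rightarrow> nat" where
  "maxcol p L = (GREATEST n. \<exists>D c. nontrivial_coloring_of p L D c \<and> num_colors D c = n)"

definition Spec :: "nat \<Rightarrow> (real^3) set \<Rightarrow> nat set" where
  "Spec p L = {n. n > 0 \<and> (\<exists>D c. nontrivial_coloring_of p L D c \<and> num_colors D c = n)}"

definition minimal_coloring_of ::
    "nat \<Rightarrow> (real^3) set \<Rightarrow> (real^3) set \<Rightarrow> ((real^3) set \<Rightarrow> int) \<Rightarrow> bool" where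
  "minimal_coloring_of p L D c \<longleftrightarrow>
     nontrivial_coloring_of p L D c \<and> num_colors D c = mincol p L"

text \<open>Some crossing has over-arc color \<open>b\<close> and under-arc colors \<open>a\<close> and \<open>d\<close>, modulo \<open>p\<close>.\<close>

definition has_colored_crossing ::
    "nat \<Rightarrow> (real^3) set \<Rightarrow> ((real^3) set \<Rightarrow> int) \<Rightarrow> int \<Rightarrow> int \<Rightarrow> int \<Rightarrow> bool" where
  "has_colored_crossing p D c b a d \<longleftrightarrow>
     (\<exists>A B C. crossing_arcs D A B C \<and>
        [c A = b] (mod int p) \<and> [c B = a] (mod int p) \<and> [c C = d] (mod int p))"

end

theory Submission
  imports Defs
begin

text \<open>
  Write \<open>s = b - a\<close>.  A crossing with over-color \<open>b\<close> and under-colors \<open>a\<close> and \<open>d = 2 b - a\<close>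
  shows three consecutive terms of the arithmetic progression with difference \<open>s\<close>.  Near that
  crossing, pull a finger of the under-strand, on its side of color \<open>d\<close>, over the over-strand
  (a Reidemeister move of type II).  The finger covers a short piece of the over-strand, the tip,
  between two new crossings.  All old colors can be kept, and the coloring condition at the new
  crossings gives the tip the color \<open>2 d - b = b + 2 s\<close>, the next term of the progression.  At a new
  crossing the over-color is \<open>d\<close> and the under-colors are \<open>b\<close> and \<open>2 d - b\<close>, so the move can be
  repeated (\<open>new_color_by_finger\<close>, \<open>colors_in_progression\<close>).
  
  Each move adds at most one color, and if \<open>s\<close> is invertible modulo \<open>p\<close>, then the progression
  eventually meets every residue.  So, starting from a minimal coloring, the number of colors takes
  every value from \<open>mincol\<close> to \<open>p\<close>.  As no coloring uses more than \<open>p\<close> colors, \<open>maxcol\<close>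
  is \<open>p\<close> and the spectrum has no gaps (\<open>all_numbers_of_colors\<close>, \<open>Spec_eq_interval\<close>).  The first part
  of the theorem is the case \<open>a = 0\<close>, \<open>b = 1\<close> of the second.
  
  Two devices make this precise for polygonal links.  First, a coloring of arcs is replaced by a
  function on the points of the diagram that is constant on connected components, with a condition on
  the colors that occur close to each under-point; the arcs created or cut by the move then never
  have to be enumerated.  Second, around a crossing there are affine coordinates, respecting the
  vertical direction, in which the diagram consists of two straight lines
  (\<open>crossing_chart_exists\<close>).  There the finger move is an explicit piecewise linear homeomorphism that
  moves every point along one fixed direction, so that the ambient isotopy, the new crossings
  and the new colors can all be computed in coordinates.
\<close>

section \<open>Ambient isotopy and polygonal links\<close>

lemma ambient_isotopic_refl: "ambient_isotopic K K"
  unfolding ambient_isotopic_def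
  by (rule exI[of _ id]) (auto intro!: exI[of _ id] simp: homeomorphism_def)

lemma ambient_isotopic_trans:
  assumes "ambient_isotopic K L" "ambient_isotopic L M"
  shows "ambient_isotopic K M"
proof -
  let ?P = "\<lambda>g :: real^3 \<Rightarrow> real^3. \<exists>g'. homeomorphism UNIV UNIV g g'"
  obtain f where f: "homotopic_with_canon ?P UNIV UNIV id f" "f ` K = L"
    using assms(1) by (auto simp: ambient_isotopic_def)
  obtain g where g: "homotopic_with_canon ?P UNIV UNIV id g" "g ` L = M"
    using assms(2) by (auto simp: ambient_isotopic_def)
  have "?P f"
    using f(1) homotopic_with_imp_property by blast
  then obtain f' where f': "homeomorphism UNIV UNIV f f'" by blast
  have "homotopic_with_canon (\<lambda>h. ?P (h \<circ> f)) UNIV UNIV id g"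
    using g(1) by (rule homotopic_with_mono) (use f' homeomorphism_compose in blast)
  then have "homotopic_with_canon ?P UNIV UNIV (id \<circ> f) (g \<circ> f)"
    by (rule homotopic_with_compose_continuous_right)
      (use f' in \<open>auto simp: homeomorphism_def\<close>)
  then have "homotopic_with_canon ?P UNIV UNIV id (g \<circ> f)"
    using f(1) homotopic_with_trans by fastforce
  then show ?thesis
    using f(2) g(2) unfolding ambient_isotopic_def by (metis image_comp)
qed

lemma components_homeomorphic_image:
  assumes "homeomorphism S T f g" "C \<in> components T"
  shows "\<exists>B \<in> components S. C = f ` B \<and> C homeomorphic B"
proof -
  obtain y where y: "y \<in> T" "C = connected_component_set T y"
    using assms(2) by (auto simp: components_def)
  have gy: "g y \<in> S" "f (g y) = y"
    using assms(1) y(1) by (auto simp: homeomorphism_def)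
  let ?B = "connected_component_set S (g y)"
  have C: "C = f ` ?B"
    using connected_component_set_homeomorphism[OF assms(1) gy(1)] gy(2) y(2) by simp
  have "?B \<subseteq> S" by (rule connected_component_subset)
  then have "homeomorphism ?B C f g"
    using homeomorphism_of_subsets[OF assms(1)] C by blast
  then have "C homeomorphic ?B"
    using homeomorphic_def homeomorphic_sym by blast
  with C gy(1) show ?thesis
    by (auto simp: components_def)
qed

text \<open>
  A polygonal set is its own witness of tameness, so only the topology of the components has to be
  carried over.
\<close>

lemma is_link_homeomorphic_image:
  assumes "is_link K" "homeomorphism K K' f g" "polygonal K'"
  shows "is_link K'"
proof -
  have "components K' \<subseteq> image f ` components K"
    using components_homeomorphic_image[OF assms(2)] by blast
  moreover have "finite (components K)"
    using assms(1) by (simp add: is_link_def)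
  ultimately have "finite (components K')"
    using finite_subset by blast
  moreover have "C homeomorphic sphere (0::complex) 1" if "C \<in> components K'" for C
    using components_homeomorphic_image[OF assms(2) that] assms(1)
    by (auto simp: is_link_def intro: homeomorphic_trans)
  moreover have "K' \<noteq> {}"
    using assms(1,2) by (auto simp: is_link_def homeomorphism_def)
  ultimately show ?thesis
    unfolding is_link_def using assms(3) ambient_isotopic_refl by blast
qed

lemma polygonal_closed_segment: "polygonal (closed_segment a b)"
  unfolding polygonal_def by (rule exI[of _ "{(a, b)}"]) auto

lemma polygonal_empty: "polygonal {}"
  unfolding polygonal_def by (rule exI[of _ "{}"]) auto

lemma polygonal_Un:
  assumes "polygonal K" "polygonal L"
  shows "polygonal (K \<union> L)"
proof -
  obtain E F where "finite E" "K = (\<Union>(a, b)\<in>E. closed_segment a b)"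
    "finite F" "L = (\<Union>(a, b)\<in>F. closed_segment a b)"
    using assms by (auto simp: polygonal_def)
  then show ?thesis
    unfolding polygonal_def by (intro exI[of _ "E \<union> F"]) auto
qed

lemma polygonal_Union:
  assumes "finite A" "\<And>K. K \<in> A \<Longrightarrow> polygonal K"
  shows "polygonal (\<Union>A)"
  using assms by (induction A) (auto intro: polygonal_Un polygonal_empty)

text \<open>
  This is how a piece is cut out of a polygonal link: the complement of an open convex polyhedron is a
  finite union of closed half-spaces.
\<close>

lemma polygonal_Int_closed_convex:
  assumes "polygonal K" "closed S" "convex S"
  shows "polygonal (K \<inter> S)"
proof -
  obtain E where E: "finite E" "K = (\<Union>(a, b)\<in>E. closed_segment a b)"
    using assms by (auto simp: polygonal_def)
  have "polygonal (closed_segment a b \<inter> S)" for a b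
  proof (cases "closed_segment a b \<inter> S = {}")
    case False
    moreover have "compact (closed_segment a b \<inter> S)"
      using assms(2) by (simp add: compact_Int_closed)
    moreover have "convex (closed_segment a b \<inter> S)"
      using assms(3) by (simp add: convex_Int)
    moreover have "collinear (closed_segment a b \<inter> S)"
      by (meson collinear_closed_segment collinear_subset inf_le1)
    ultimately obtain c d where "closed_segment a b \<inter> S = closed_segment c d"
      by (rule compact_convex_collinear_segment)
    then show ?thesis
      using polygonal_closed_segment by simp
  qed (simp add: polygonal_empty)
  then have "polygonal (\<Union>((\<lambda>(a, b). closed_segment a b \<inter> S) ` E))"
    using E(1) by (intro polygonal_Union) auto
  also have "\<Union>((\<lambda>(a, b). closed_segment a b \<inter> S) ` E) = K \<inter> S"
    using E(2) by auto
  finally show ?thesis .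
qed

lemma polygonal_compact:
  assumes "polygonal K"
  shows "compact K"
  using assms unfolding polygonal_def by (auto intro!: compact_UN)

lemma straight_atI:
  assumes "open W" "x \<in> W" "D \<inter> W = range (\<lambda>t. x + t *\<^sub>R u) \<inter> W"
  shows "straight_at D x u"
proof -
  obtain e where "e > 0" "ball x e \<subseteq> W"
    using assms(1,2) open_contains_ball by blast
  then show ?thesis
    unfolding straight_at_def using assms(3) by (intro exI[of _ e]) blast
qed

lemma range_line_scaleR:
  assumes "r \<noteq> 0"
  shows "range (\<lambda>t. x + t *\<^sub>R (r *\<^sub>R u)) = range (\<lambda>t. x + t *\<^sub>R (u::real^3))"
proof -
  have "(\<lambda>t. x + t *\<^sub>R (r *\<^sub>R u)) = (\<lambda>t. x + t *\<^sub>R u) \<circ> (\<lambda>t. t * r)"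
    by auto
  moreover have "surj (\<lambda>t. t * r)"
    using assms by (intro surjI[of _ "\<lambda>t. t / r"]) simp
  ultimately show ?thesis by (simp only: image_comp [symmetric])
qed

lemma straight_at_scaleR:
  assumes "straight_at D x u" "r \<noteq> 0"
  shows "straight_at D x (r *\<^sub>R u)"
  using assms(1) unfolding straight_at_def range_line_scaleR[OF assms(2)] .

lemma straight_at_localized:
  assumes "straight_at D x u" "open W" "x \<in> W" "D \<inter> W = D' \<inter> W"
  shows "straight_at D' x u"
proof -
  obtain e where e: "e > 0" "D \<inter> ball x e = range (\<lambda>t. x + t *\<^sub>R u) \<inter> ball x e"
    using assms(1) by (auto simp: straight_at_def)
  show ?thesis
    by (rule straight_atI[of "ball x e \<inter> W"]) (use e assms in auto)
qed

section \<open>Colorings as functions on the points of a diagram\<close>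

definition regular_part :: "(real^3) set \<Rightarrow> (real^3) set" where
  "regular_part D = D - under_points D"

text \<open>
  The set of colors seen in all sufficiently small balls around \<open>y\<close>.  At an under-point it
  consists of the colors of the two sides of the under-strand, which coincide if the set is a
  singleton; so the set determines the sum of the two under-colors.  It depends only on the diagram
  near \<open>y\<close> and mentions neither arcs nor directions.
\<close>

definition colors_near :: "(real^3) set \<Rightarrow> (real^3 \<Rightarrow> int) \<Rightarrow> real^3 \<Rightarrow> int set \<Rightarrow> bool" where
  "colors_near D \<gamma> y S \<longleftrightarrow> (\<forall>\<^sub>F e in at_right 0. \<gamma> ` (regular_part D \<inter> ball y e) = S)"

definition point_coloring :: "nat \<Rightarrow> (real^3) set \<Rightarrow> (real^3 \<Rightarrow> int) \<Rightarrow> bool" where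
  "point_coloring p D \<gamma> \<longleftrightarrow>
     \<gamma> ` regular_part D \<subseteq> {0..<int p} \<and>
     (\<forall>x y. connected_component (regular_part D) x y \<longrightarrow> \<gamma> x = \<gamma> y) \<and>
     (\<forall>x y. crossing D x y \<longrightarrow>
        (\<exists>\<alpha> \<beta>. colors_near D \<gamma> y {\<alpha>, \<beta>} \<and> [2 * \<gamma> x = \<alpha> + \<beta>] (mod int p)))"

definition has_colored_crossing_point ::
    "nat \<Rightarrow> (real^3) set \<Rightarrow> (real^3 \<Rightarrow> int) \<Rightarrow> int \<Rightarrow> int \<Rightarrow> int \<Rightarrow> bool" where
  "has_colored_crossing_point p D \<gamma> b a d \<longleftrightarrow>
     (\<exists>x y \<alpha> \<beta>. crossing D x y \<and> colors_near D \<gamma> y {\<alpha>, \<beta>} \<and>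
        [\<gamma> x = b] (mod int p) \<and> [\<alpha> = a] (mod int p) \<and> [\<beta> = d] (mod int p))"

lemma colors_near_cong:
  assumes "colors_near D \<gamma> y S" "open W" "y \<in> W" "regular_part D \<inter> W = regular_part D' \<inter> W"
    and "\<And>z. z \<in> regular_part D \<inter> W \<Longrightarrow> \<gamma> z = \<gamma>' z"
  shows "colors_near D' \<gamma>' y S"
proof -
  obtain r where r: "r > 0" "ball y r \<subseteq> W"
    using assms(2,3) open_contains_ball by blast
  have "\<forall>\<^sub>F e in at_right 0. e < r"
    using r(1) eventually_at_right_less eventually_at_right by blast
  with assms(1) show ?thesis
    unfolding colors_near_def
  proof eventually_elim
    case (elim e)
    then have "ball y e \<subseteq> W" using r(2) by fastforce
    then have "regular_part D \<inter> ball y e = regular_part D' \<inter> ball y e"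
      using assms(4) by blast
    with elim(1) \<open>ball y e \<subseteq> W\<close> assms(5) show ?case
      by (smt (verit) Int_iff image_cong subset_iff)
  qed
qed

lemma colors_near_unique:
  assumes "colors_near D \<gamma> y S" "colors_near D \<gamma> y T"
  shows "S = T"
proof -
  have "\<forall>\<^sub>F e :: real in at_right 0. S = T"
    using assms unfolding colors_near_def by eventually_elim simp
  then show ?thesis by simp
qed

text \<open>
  An over-point that is also an under-point would be the middle one of three points of the diagram on
  a vertical line.
\<close>

lemma over_point_regular:
  assumes "diagram D" "crossing D x y"
  shows "x \<in> regular_part D"
proof -
  have "\<not> crossing D z x" for z
  proof
    assume "crossing D z x"
    with assms(2) have *: "z \<in> D" "x \<in> D" "y \<in> D" "proj z = proj x" "proj x = proj y"
      "y $ 3 < x $ 3" "x $ 3 < z $ 3"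
      by (auto simp: crossing_def)
    then have "z = x \<or> x = y \<or> z = y"
      using assms(1) unfolding diagram_def by blast
    with * show False by auto
  qed
  with assms(2) show ?thesis
    by (auto simp: regular_part_def under_points_def crossing_def)
qed

lemma finite_under_points:
  assumes "diagram D"
  shows "finite (under_points D)"
proof -
  have "under_points D = snd ` {(x, y). crossing D x y}"
    by (force simp: under_points_def)
  then show ?thesis
    using assms by (simp add: diagram_def)
qed

lemma arcs_eq: "arcs D = components (regular_part D)"
  by (simp add: arcs_def regular_part_def)

text \<open>
  Near an under-point the diagram is a straight segment without further under-points.  Removing the
  under-point leaves two half-segments; each is connected and hence lies in a single arc.
\<close>

lemma arcs_near_under_point:
  assumes "diagram D" "crossing D x y"
  shows "\<exists>B C e0. B \<in> arcs D \<and> C \<in> arcs D \<and> e0 > 0 \<and>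
           (\<forall>e. 0 < e \<and> e \<le> e0 \<longrightarrow> {U \<in> arcs D. U \<inter> ball y e \<noteq> {}} = {B, C})"
proof -
  obtain u v0 :: "real^3" where v0: "straight_at D y v0" "u $ 1 * v0 $ 2 \<noteq> u $ 2 * v0 $ 1"
    using assms unfolding diagram_def by blast
  then have "v0 \<noteq> 0" by auto
  define v where "v = (1 / norm v0) *\<^sub>R v0"
  have nv: "norm v = 1" using \<open>v0 \<noteq> 0\<close> by (simp add: v_def)
  have "straight_at D y v"
    unfolding v_def using v0(1) \<open>v0 \<noteq> 0\<close> by (intro straight_at_scaleR) auto
  then obtain e1 where e1: "e1 > 0" "D \<inter> ball y e1 = range (\<lambda>t. y + t *\<^sub>R v) \<inter> ball y e1"
    by (auto simp: straight_at_def)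
  obtain e2 where e2: "e2 > 0" "\<And>z. z \<in> under_points D \<Longrightarrow> z \<noteq> y \<Longrightarrow> e2 \<le> dist y z"
    using finite_set_avoid[OF finite_under_points[OF assms(1)], of y] by blast
  define e0 where "e0 = min e1 e2"
  have e0: "e0 > 0" using e1 e2 by (simp add: e0_def)
  have y: "y \<in> under_points D" using assms(2) by (auto simp: under_points_def)
  have reg: "regular_part D \<inter> ball y e = {y + t *\<^sub>R v |t. t \<noteq> 0 \<and> \<bar>t\<bar> < e}" if "e \<le> e0" for e
  proof -
    have *: "y + t *\<^sub>R v \<in> ball y e \<longleftrightarrow> \<bar>t\<bar> < e" for t
      using nv by (simp add: dist_norm)
    have "z \<in> regular_part D \<inter> ball y e \<longleftrightarrow> z \<in> D \<inter> ball y e1 \<and> z \<in> ball y e \<and> z \<noteq> y" for z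
      using that y e2(2)[of z] by (auto simp: regular_part_def e0_def)
    moreover have "z \<in> D \<inter> ball y e1 \<longleftrightarrow> (\<exists>t. z = y + t *\<^sub>R v) \<and> z \<in> ball y e1" for z
      using e1(2) by auto
    moreover have "ball y e \<subseteq> ball y e1" using that by (auto simp: e0_def)
    ultimately have "z \<in> regular_part D \<inter> ball y e \<longleftrightarrow>
        (\<exists>t. z = y + t *\<^sub>R v) \<and> z \<in> ball y e \<and> z \<noteq> y" for z
      by blast
    moreover have "y + t *\<^sub>R v \<noteq> y \<longleftrightarrow> t \<noteq> 0" for t
      using nv by auto
    ultimately have "z \<in> regular_part D \<inter> ball y e \<longleftrightarrow> (\<exists>t. z = y + t *\<^sub>R v \<and> t \<noteq> 0 \<and> \<bar>t\<bar> < e)" for z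
      by (metis *)
    then show ?thesis by blast
  qed
  have half: "connected ((\<lambda>t. y + t *\<^sub>R v) ` I)" if "connected I" for I :: "real set"
    using that by (intro connected_continuous_image continuous_intros)
  have same: "connected_component (regular_part D) (y + s *\<^sub>R v) (y + t *\<^sub>R v)"
    if "0 < s * t" "\<bar>s\<bar> < e0" "\<bar>t\<bar> < e0" for s t
  proof -
    define I where "I = (if s > 0 then {0<..<e0} else {-e0<..<0})"
    have "(\<lambda>t. y + t *\<^sub>R v) ` I \<subseteq> regular_part D \<inter> ball y e0"
      by (subst reg) (auto simp: I_def)
    moreover have "s \<in> I" "t \<in> I"
      using that by (auto simp: I_def zero_less_mult_iff)
    moreover have "connected I" by (auto simp: I_def)
    ultimately show ?thesis
      unfolding connected_component_def using half by (meson imageI le_inf_iff)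
  qed
  define B where "B = connected_component_set (regular_part D) (y + (e0 / 2) *\<^sub>R v)"
  define C where "C = connected_component_set (regular_part D) (y + (- e0 / 2) *\<^sub>R v)"
  have in_reg: "y + t *\<^sub>R v \<in> regular_part D" if "t \<noteq> 0" "\<bar>t\<bar> < e0" for t
    using reg[of e0] that by auto
  have BC: "B \<in> arcs D" "C \<in> arcs D"
    unfolding arcs_eq B_def C_def using in_reg[of "e0/2"] in_reg[of "-e0/2"] e0
    by (auto simp: components_def)
  have "{U \<in> arcs D. U \<inter> ball y e \<noteq> {}} = {B, C}" if e: "0 < e" "e \<le> e0" for e
  proof (intro equalityI subsetI)
    fix U assume "U \<in> {U \<in> arcs D. U \<inter> ball y e \<noteq> {}}"
    then obtain z where z: "z \<in> U" "z \<in> ball y e" and U: "U \<in> components (regular_part D)"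
      by (auto simp: arcs_eq)
    then have "z \<in> regular_part D \<inter> ball y e"
      using in_components_subset by blast
    then obtain t where t: "z = y + t *\<^sub>R v" "t \<noteq> 0" "\<bar>t\<bar> < e"
      using reg[OF e(2)] by auto
    have Uz: "U = connected_component_set (regular_part D) z"
      using U z(1) by (metis (full_types) componentsE connected_component_eq)
    show "U \<in> {B, C}"
    proof (cases "t > 0")
      case True
      then have "connected_component (regular_part D) (y + (e0/2) *\<^sub>R v) z"
        unfolding t(1) using same[of "e0/2" t] t e e0 by auto
      then have "U = B" unfolding Uz B_def
        by (metis connected_component_eq mem_Collect_eq)
      then show ?thesis by simp
    next
      case False
      then have "connected_component (regular_part D) (y + (-e0/2) *\<^sub>R v) z"
        unfolding t(1) using same[of "-e0/2" t] t e e0 by (auto simp: mult_less_0_iff)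
      then have "U = C" unfolding Uz C_def
        by (metis connected_component_eq mem_Collect_eq)
      then show ?thesis by simp
    qed
  next
    fix U assume "U \<in> {B, C}"
    moreover have "y + (e/2) *\<^sub>R v \<in> B \<inter> ball y e"
      using same[of "e0/2" "e/2"] e e0 nv by (auto simp: B_def dist_norm)
    moreover have "y + (-e/2) *\<^sub>R v \<in> C \<inter> ball y e"
      using same[of "-e0/2" "-e/2"] e e0 nv by (auto simp: C_def dist_norm)
    ultimately show "U \<in> {U \<in> arcs D. U \<inter> ball y e \<noteq> {}}"
      using BC by blast
  qed
  with BC e0 show ?thesis by blast
qed

lemma arcs_at_under_point:
  assumes "diagram D" "crossing D x y"
  shows "\<exists>B C. B \<in> arcs D \<and> C \<in> arcs D \<and> {U \<in> arcs D. y \<in> closure U} = {B, C} \<and>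
           (\<forall>\<^sub>F e in at_right 0. {U \<in> arcs D. U \<inter> ball y e \<noteq> {}} = {B, C})"
proof -
  obtain B C e0 where BC: "B \<in> arcs D" "C \<in> arcs D" and e0: "e0 > 0"
    and eq': "\<forall>e. 0 < e \<and> e \<le> e0 \<longrightarrow> {U \<in> arcs D. U \<inter> ball y e \<noteq> {}} = {B, C}"
    using arcs_near_under_point[OF assms] by (elim exE conjE) (rule that)
  have eq: "{U \<in> arcs D. U \<inter> ball y e \<noteq> {}} = {B, C}" if "0 < e" "e \<le> e0" for e
    using eq' that by blast
  have "U \<in> {B, C}" if "U \<in> arcs D" "y \<in> closure U" for U
  proof -
    have "\<exists>z\<in>U. dist z y < e0" using that(2) e0 closure_approachable by blast
    then have "U \<inter> ball y e0 \<noteq> {}" by (auto simp: dist_commute)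
    with that(1) have "U \<in> {U \<in> arcs D. U \<inter> ball y e0 \<noteq> {}}" by blast
    then show ?thesis unfolding eq[OF e0 order_refl] .
  qed
  moreover have "y \<in> closure U" if "U \<in> {B, C}" for U
    unfolding closure_approachable
  proof (intro allI impI)
    fix e :: real assume "e > 0"
    have "U \<in> {U \<in> arcs D. U \<inter> ball y (min e e0) \<noteq> {}}"
      using that \<open>e > 0\<close> e0 by (subst eq) auto
    then have "U \<inter> ball y (min e e0) \<noteq> {}" by blast
    then show "\<exists>z\<in>U. dist z y < e" by (auto simp: dist_commute)
  qed
  ultimately have "{U \<in> arcs D. y \<in> closure U} = {B, C}" using BC by blast
  moreover have "\<forall>\<^sub>F e in at_right 0. {U \<in> arcs D. U \<inter> ball y e \<noteq> {}} = {B, C}"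
    unfolding eventually_at_right_field
    by (intro exI[of _ e0] conjI allI impI e0 eq) auto
  ultimately show ?thesis using BC by blast
qed

definition arc_colors :: "(real^3) set \<Rightarrow> (real^3 \<Rightarrow> int) \<Rightarrow> ((real^3) set \<Rightarrow> int) \<Rightarrow> bool" where
  "arc_colors D \<gamma> c \<longleftrightarrow> (\<forall>U\<in>arcs D. \<forall>x\<in>U. \<gamma> x = c U)"

lemma arc_colors_image:
  assumes "arc_colors D \<gamma> c"
  shows "\<gamma> ` (regular_part D \<inter> S) = c ` {U \<in> arcs D. U \<inter> S \<noteq> {}}"
proof (intro equalityI subsetI)
  fix k assume "k \<in> \<gamma> ` (regular_part D \<inter> S)"
  then obtain x where x: "x \<in> regular_part D" "x \<in> S" "k = \<gamma> x" by blast
  then have "x \<in> \<Union>(components (regular_part D))" by simp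
  then obtain U where "U \<in> arcs D" "x \<in> U"
    unfolding arcs_eq by blast
  with x assms show "k \<in> c ` {U \<in> arcs D. U \<inter> S \<noteq> {}}"
    by (auto simp: arc_colors_def)
next
  fix k assume "k \<in> c ` {U \<in> arcs D. U \<inter> S \<noteq> {}}"
  then obtain U x where U: "U \<in> arcs D" "x \<in> U" "x \<in> S" "k = c U" by blast
  then have "x \<in> regular_part D"
    using in_components_subset unfolding arcs_eq by blast
  moreover have "k = \<gamma> x"
    using U assms by (simp add: arc_colors_def)
  ultimately show "k \<in> \<gamma> ` (regular_part D \<inter> S)"
    using U(3) by blast
qed

lemma arc_colors_range:
  assumes "arc_colors D \<gamma> c"
  shows "\<gamma> ` regular_part D = c ` arcs D"
proof -
  have "{U \<in> arcs D. U \<inter> UNIV \<noteq> {}} = arcs D"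
    using in_components_nonempty by (auto simp: arcs_eq)
  then show ?thesis
    using arc_colors_image[OF assms, of UNIV] by simp
qed

text \<open>
  The translation between the two descriptions of a crossing: arcs having the under-point in their
  closure on one hand, colors in small balls on the other.
\<close>

lemma arc_colors_near:
  assumes "diagram D" "arc_colors D \<gamma> c" "crossing D x y"
  shows "{U \<in> arcs D. y \<in> closure U} = {B, C} \<Longrightarrow> colors_near D \<gamma> y {c B, c C}"
    and "\<exists>B C. {U \<in> arcs D. y \<in> closure U} = {B, C}"
proof -
  obtain B' C' where 1: "{U \<in> arcs D. y \<in> closure U} = {B', C'}"
    and 2: "\<forall>\<^sub>F e in at_right 0. {U \<in> arcs D. U \<inter> ball y e \<noteq> {}} = {B', C'}"
    using arcs_at_under_point[OF assms(1,3)] by (elim exE conjE) (rule that)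
  show "\<exists>B C. {U \<in> arcs D. y \<in> closure U} = {B, C}" using 1 by blast
  assume "{U \<in> arcs D. y \<in> closure U} = {B, C}"
  with 1 have eq: "{B', C'} = {B, C}" by simp
  show "colors_near D \<gamma> y {c B, c C}"
    unfolding colors_near_def arc_colors_image[OF assms(2)] using 2
  proof (rule eventually_mono)
    fix e assume "{U \<in> arcs D. U \<inter> ball y e \<noteq> {}} = {B', C'}"
    then show "c ` {U \<in> arcs D. U \<inter> ball y e \<noteq> {}} = {c B, c C}"
      unfolding eq by (metis image_empty image_insert)
  qed
qed

lemma crossing_arcs_point:
  assumes "diagram D" "arc_colors D \<gamma> c" "crossing_arcs D A B C"
  shows "\<exists>x y. crossing D x y \<and> \<gamma> x = c A \<and> colors_near D \<gamma> y {c B, c C}"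
proof -
  obtain x y where xy: "crossing D x y" "A \<in> arcs D" "x \<in> A"
    and BC: "{U \<in> arcs D. y \<in> closure U} = {B, C}"
    using assms(3) unfolding crossing_arcs_def by blast
  have "\<gamma> x = c A"
    using assms(2) xy(2,3) by (simp add: arc_colors_def)
  with xy(1) arc_colors_near(1)[OF assms(1,2) xy(1) BC] show ?thesis by blast
qed

lemma crossing_arcs_exist:
  assumes "diagram D" "arc_colors D \<gamma> c" "crossing D x y"
  shows "\<exists>A B C. crossing_arcs D A B C \<and> \<gamma> x = c A \<and> colors_near D \<gamma> y {c B, c C}"
proof -
  obtain B C where BC: "{U \<in> arcs D. y \<in> closure U} = {B, C}"
    using arc_colors_near(2)[OF assms] by blast
  have "x \<in> \<Union>(components (regular_part D))"
    using over_point_regular[OF assms(1,3)] by simp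
  then obtain A where A: "A \<in> arcs D" "x \<in> A"
    unfolding arcs_eq by blast
  have "crossing_arcs D A B C"
    unfolding crossing_arcs_def using assms(3) A BC by blast
  moreover have "\<gamma> x = c A"
    using assms(2) A by (simp add: arc_colors_def)
  ultimately show ?thesis
    using arc_colors_near(1)[OF assms BC] by blast
qed

lemma coloring_iff_point_coloring:
  assumes "diagram D" "arc_colors D \<gamma> c"
  shows "coloring p D c \<longleftrightarrow> point_coloring p D \<gamma>"
proof
  assume c: "coloring p D c"
  have "\<gamma> x = \<gamma> y" if "connected_component (regular_part D) x y" for x y
  proof -
    have "connected_component_set (regular_part D) x \<in> arcs D"
      using that by (auto simp: arcs_eq components_def dest: connected_component_in)
    moreover have "x \<in> connected_component_set (regular_part D) x"
      using that by (auto dest: connected_component_in)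
    ultimately show ?thesis
      using assms(2) that unfolding arc_colors_def by (metis mem_Collect_eq)
  qed
  moreover have "\<exists>\<alpha> \<beta>. colors_near D \<gamma> y {\<alpha>, \<beta>} \<and> [2 * \<gamma> x = \<alpha> + \<beta>] (mod int p)"
    if crossing: "crossing D x y" for x y
  proof -
    obtain A B C where "crossing_arcs D A B C" "\<gamma> x = c A" "colors_near D \<gamma> y {c B, c C}"
      using crossing_arcs_exist[OF assms crossing] by (elim exE conjE)
    moreover have "[2 * c A = c B + c C] (mod int p)"
      using c \<open>crossing_arcs D A B C\<close> unfolding coloring_def by (elim conjE allE impE)
    ultimately show ?thesis by (intro exI[of _ "c B"] exI[of _ "c C"]) simp
  qed
  moreover have "\<gamma> ` regular_part D \<subseteq> {0..<int p}"
    using c unfolding coloring_def arc_colors_range[OF assms(2)] by (rule conjunct1)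
  ultimately show "point_coloring p D \<gamma>"
    unfolding point_coloring_def by (intro conjI allI impI)
next
  assume \<gamma>: "point_coloring p D \<gamma>"
  have "[2 * c A = c B + c C] (mod int p)" if arcs: "crossing_arcs D A B C" for A B C
  proof -
    obtain x y where xy: "crossing D x y" "\<gamma> x = c A" "colors_near D \<gamma> y {c B, c C}"
      using crossing_arcs_point[OF assms arcs] by blast
    then obtain \<alpha> \<beta> where "colors_near D \<gamma> y {\<alpha>, \<beta>}" "[2 * \<gamma> x = \<alpha> + \<beta>] (mod int p)"
      using \<gamma> unfolding point_coloring_def by blast
    moreover from this(1) xy(3) have "{\<alpha>, \<beta>} = {c B, c C}"
      by (rule colors_near_unique)
    ultimately show ?thesis
      using xy(2) by (auto simp: doubleton_eq_iff add.commute)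
  qed
  moreover have "c ` arcs D \<subseteq> {0..<int p}"
    using \<gamma> unfolding point_coloring_def arc_colors_range[OF assms(2)] by (rule conjunct1)
  ultimately show "coloring p D c"
    unfolding coloring_def by (intro conjI allI impI)
qed

lemma has_colored_crossing_imp_point:
  assumes "diagram D" "arc_colors D \<gamma> c" "has_colored_crossing p D c b a d"
  shows "has_colored_crossing_point p D \<gamma> b a d"
proof -
  obtain A B C where ABC: "crossing_arcs D A B C"
    "[c A = b] (mod int p)" "[c B = a] (mod int p)" "[c C = d] (mod int p)"
    using assms(3) unfolding has_colored_crossing_def by (elim exE conjE)
  then obtain x y where "crossing D x y" "\<gamma> x = c A" "colors_near D \<gamma> y {c B, c C}"
    using crossing_arcs_point[OF assms(1,2)] by metis
  moreover have "[\<gamma> x = b] (mod int p)"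
    unfolding \<open>\<gamma> x = c A\<close> by (rule ABC(2))
  ultimately show ?thesis
    unfolding has_colored_crossing_point_def using ABC(3,4) by (intro exI conjI)
qed

lemma arc_colors_of_coloring:
  "arc_colors D (\<lambda>x. c (connected_component_set (regular_part D) x)) c"
  unfolding arc_colors_def arcs_eq
proof (intro ballI)
  fix U x assume "U \<in> components (regular_part D)" "x \<in> U"
  then have "connected_component_set (regular_part D) x = U"
    by (elim componentsE) (simp add: connected_component_eq)
  then show "c (connected_component_set (regular_part D) x) = c U" by simp
qed

lemma arc_colors_of_point_coloring:
  assumes "point_coloring p D \<gamma>"
  shows "arc_colors D \<gamma> (\<lambda>U. \<gamma> (SOME x. x \<in> U))"
  unfolding arc_colors_def
proof (intro ballI)
  fix U x assume "U \<in> arcs D" "x \<in> U"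
  then have "(SOME x. x \<in> U) \<in> U" by (auto intro: someI)
  with \<open>U \<in> arcs D\<close> \<open>x \<in> U\<close> have "connected_component (regular_part D) x (SOME x. x \<in> U)"
    unfolding arcs_eq
    by (meson connected_component_def in_components_connected in_components_subset)
  with assms show "\<gamma> x = \<gamma> (SOME x. x \<in> U)"
    unfolding point_coloring_def by blast
qed

section \<open>The finger move at a crossing\<close>

text \<open>
  The finger grows from the segment from \<open>(0, 1, 0)\<close> to \<open>(0, 2, 0)\<close> of the under-strand; the midpoint
  \<open>(0, 3 / 2, 0)\<close> is to be moved to the apex \<open>(1, - 1, 4)\<close>, that is, by the vector
  \<open>W = (1, - 5 / 2, 4)\<close>.  The numbers \<open>2 m - 3 + 5 l\<close> and \<open>n - 4 l\<close> are constant on the lines in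
  direction \<open>W\<close>, and \<open>l\<close> is a parameter of such a line.  With
  \<open>h = 1 - \<bar>2 m - 3 + 5 l\<bar> - 2 \<bar>n - 4 l\<bar>\<close>, the map that adds \<open>bump\<close> to \<open>l\<close> is, on a line with \<open>h > 0\<close>,
  the piecewise linear homeomorphism that fixes everything outside \<open>{- h / 2 .. 3 / 2 * h}\<close> and sends
  \<open>0\<close> to \<open>h\<close>.  On the segment itself \<open>h\<close> is the tent function with value \<open>1\<close> at the midpoint.
\<close>

definition bump :: "real \<Rightarrow> real \<Rightarrow> real \<Rightarrow> real" where
  "bump l m n = max 0 (1 - \<bar>2 * m - 3 + 5 * l\<bar> - 2 * \<bar>n - 4 * l\<bar> + min (2 * l) (- (2 / 3) * l))"

lemma bump_bounds: "0 \<le> bump l m n" "bump l m n \<le> 1"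
  unfolding bump_def max_def min_def by (auto simp: abs_if)

text \<open>
  The two assumed equations say that the points lie on a common line in direction
  \<open>(1, - 5 / 2, 4)\<close>.  Since the slope \<open>- 2 / 3\<close> is greater than \<open>- 1\<close>, adding \<open>bump\<close>, or a fraction
  of it, to the parameter \<open>l\<close> of such a line is still strictly increasing.
\<close>

lemma bump_slope:
  assumes "2 * m + 5 * l = 2 * m' + 5 * l'" "n - 4 * l = n' - 4 * l'" "l \<le> l'"
  shows "bump l m n - bump l' m' n' \<le> 2 / 3 * (l' - l)"
proof -
  have "2 * m - 3 + 5 * l = 2 * m' - 3 + 5 * l'" using assms(1) by simp
  then show ?thesis
    unfolding bump_def assms(2) using assms(3) by (simp add: max_def min_def) argo
qed

lemma bump_support:
  assumes "bump l m n \<noteq> 0"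
  shows "\<bar>l\<bar> < 3" "\<bar>m\<bar> < 3"
  using assms unfolding bump_def max_def min_def by (auto split: if_splits simp: abs_if)

text \<open>
  The over-strand stays fixed: it meets the triangle spanned by the finger only in projection, where
  its height \<open>1\<close> is too far from the height \<open>4 l\<close> of the triangle.
\<close>

lemma bump_over_line: "bump l 0 1 = 0"
  unfolding bump_def max_def min_def by (auto simp: abs_if)

lemma bump_under_line: "bump 0 m 0 = max 0 (1 - \<bar>2 * m - 3\<bar>)"
  by (simp add: bump_def)

text \<open>
  Affine coordinates at a crossing.  The origin is the under-point, \<open>u\<close> and \<open>v\<close> are directions of the
  over- and the under-strand, and \<open>k\<close> leads vertically from the under-point to the over-point.  The
  vectors are scaled such that the vertical prism over the square of half-width \<open>3\<close> contains just the
  two strands; the number \<open>3\<close> leaves room for the support of \<open>bump\<close>.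
\<close>

locale crossing_chart =
  fixes D :: "(real^3) set" and orig u v k :: "real^3"
  assumes diagram: "diagram D"
    and vertical: "k $ 1 = 0" "k $ 2 = 0" "0 < k $ 3"
    and transversal: "u $ 1 * v $ 2 \<noteq> u $ 2 * v $ 1"
    and box: "\<And>l m n. \<bar>l\<bar> < 3 \<Longrightarrow> \<bar>m\<bar> < 3 \<Longrightarrow>
      orig + l *\<^sub>R u + m *\<^sub>R v + n *\<^sub>R k \<in> D \<longleftrightarrow> m = 0 \<and> n = 1 \<or> l = 0 \<and> n = 0"
begin

definition pt :: "real \<Rightarrow> real \<Rightarrow> real \<Rightarrow> real^3" where
  "pt l m n = orig + l *\<^sub>R u + m *\<^sub>R v + n *\<^sub>R k"

definition lam :: "real^3 \<Rightarrow> real" where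
  "lam X = ((X - orig) $ 1 * v $ 2 - (X - orig) $ 2 * v $ 1) / (u $ 1 * v $ 2 - u $ 2 * v $ 1)"

definition mu :: "real^3 \<Rightarrow> real" where
  "mu X = (u $ 1 * (X - orig) $ 2 - u $ 2 * (X - orig) $ 1) / (u $ 1 * v $ 2 - u $ 2 * v $ 1)"

definition nu :: "real^3 \<Rightarrow> real" where
  "nu X = ((X - orig) $ 3 - lam X * u $ 3 - mu X * v $ 3) / k $ 3"

lemma lam_pt [simp]: "lam (pt l m n) = l"
proof -
  have "(pt l m n - orig) $ 1 * v $ 2 - (pt l m n - orig) $ 2 * v $ 1
      = l * (u $ 1 * v $ 2 - u $ 2 * v $ 1)"
    using vertical by (simp add: pt_def algebra_simps)
  then show ?thesis using transversal by (simp add: lam_def)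
qed

lemma mu_pt [simp]: "mu (pt l m n) = m"
proof -
  have "u $ 1 * (pt l m n - orig) $ 2 - u $ 2 * (pt l m n - orig) $ 1
      = m * (u $ 1 * v $ 2 - u $ 2 * v $ 1)"
    using vertical by (simp add: pt_def algebra_simps)
  then show ?thesis using transversal by (simp add: mu_def)
qed

lemma nu_pt [simp]: "nu (pt l m n) = n"
  using vertical by (simp add: nu_def) (simp add: pt_def)

lemma pt_coords [simp]: "pt (lam X) (mu X) (nu X) = X"
proof -
  let ?d = "u $ 1 * v $ 2 - u $ 2 * v $ 1"
  have d: "?d \<noteq> 0" using transversal by simp
  have l: "lam X * ?d = (X - orig) $ 1 * v $ 2 - (X - orig) $ 2 * v $ 1"
    and m: "mu X * ?d = u $ 1 * (X - orig) $ 2 - u $ 2 * (X - orig) $ 1"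
    using d by (simp_all add: lam_def mu_def)
  have "?d * (lam X * u $ 1 + mu X * v $ 1) = ?d * (X - orig) $ 1"
    using l m by algebra
  then have 1: "lam X * u $ 1 + mu X * v $ 1 = (X - orig) $ 1"
    using d by simp
  have "?d * (lam X * u $ 2 + mu X * v $ 2) = ?d * (X - orig) $ 2"
    using l m by algebra
  then have 2: "lam X * u $ 2 + mu X * v $ 2 = (X - orig) $ 2"
    using d by simp
  have 3: "nu X * k $ 3 = (X - orig) $ 3 - lam X * u $ 3 - mu X * v $ 3"
    using vertical by (simp add: nu_def)
  show ?thesis
    unfolding vec_eq_iff forall_3 pt_def using 1 2 3 vertical by simp
qed

lemma pt_eqI: "lam X = lam Y \<Longrightarrow> mu X = mu Y \<Longrightarrow> nu X = nu Y \<Longrightarrow> X = Y"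
  by (metis pt_coords)

lemma pt_add: "pt l m n + (a *\<^sub>R u + b *\<^sub>R v + c *\<^sub>R k) = pt (l + a) (m + b) (n + c)"
  by (simp add: pt_def algebra_simps)

lemma coords_add:
  "lam (X + (a *\<^sub>R u + b *\<^sub>R v + c *\<^sub>R k)) = lam X + a"
  "mu (X + (a *\<^sub>R u + b *\<^sub>R v + c *\<^sub>R k)) = mu X + b"
  "nu (X + (a *\<^sub>R u + b *\<^sub>R v + c *\<^sub>R k)) = nu X + c"
  using pt_add[of "lam X" "mu X" "nu X" a b c] by (metis lam_pt mu_pt nu_pt pt_coords)+

lemma continuous_coords [continuous_intros]:
  assumes "continuous_on S f"
  shows "continuous_on S (\<lambda>x. lam (f x))" "continuous_on S (\<lambda>x. mu (f x))"
    "continuous_on S (\<lambda>x. nu (f x))"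
proof -
  show l: "continuous_on S (\<lambda>x. lam (f x))" and m: "continuous_on S (\<lambda>x. mu (f x))"
    unfolding lam_def mu_def using transversal assms by (auto intro!: continuous_intros)
  show "continuous_on S (\<lambda>x. nu (f x))"
    unfolding nu_def using vertical by (intro continuous_intros l m assms) auto
qed

lemma continuous_pt [continuous_intros]:
  assumes "continuous_on S f" "continuous_on S g" "continuous_on S h"
  shows "continuous_on S (\<lambda>x. pt (f x) (g x) (h x))"
  unfolding pt_def using assms by (intro continuous_intros)

lemma proj_eq_iff: "proj X = proj Y \<longleftrightarrow> lam X = lam Y \<and> mu X = mu Y"
proof
  assume "proj X = proj Y"
  then show "lam X = lam Y \<and> mu X = mu Y"
    by (simp add: proj_def lam_def mu_def)
next
  have "proj (pt l m n) = proj (pt l m n')" for l m n n'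
    using vertical by (simp add: proj_def pt_def)
  moreover assume "lam X = lam Y \<and> mu X = mu Y"
  ultimately show "proj X = proj Y" by (metis pt_coords)
qed

lemma height_less_iff: "proj X = proj Y \<Longrightarrow> X $ 3 < Y $ 3 \<longleftrightarrow> nu X < nu Y"
  unfolding proj_eq_iff using vertical(3) by (simp add: nu_def divide_less_cancel)

lemma crossing_iff:
  "crossing S X Y \<longleftrightarrow> X \<in> S \<and> Y \<in> S \<and> lam X = lam Y \<and> mu X = mu Y \<and> nu Y < nu X"
  unfolding crossing_def using height_less_iff[of Y X] proj_eq_iff[of X Y] by auto

lemma mem_box: "\<bar>lam X\<bar> < 3 \<Longrightarrow> \<bar>mu X\<bar> < 3 \<Longrightarrow>
    X \<in> D \<longleftrightarrow> mu X = 0 \<and> nu X = 1 \<or> lam X = 0 \<and> nu X = 0"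
  using box[of "lam X" "mu X" "nu X"] unfolding pt_def[symmetric] by simp

text \<open>
  The stage \<open>t\<close> of the isotopy; \<open>push 1\<close> is the finger move.
\<close>

definition push :: "real \<Rightarrow> real^3 \<Rightarrow> real^3" where
  "push t X = X + ((t * bump (lam X) (mu X) (nu X)) *\<^sub>R u + (- (5 / 2) * (t * bump (lam X) (mu X) (nu X))) *\<^sub>R v
      + (4 * (t * bump (lam X) (mu X) (nu X))) *\<^sub>R k)"

lemma coords_push:
  "lam (push t X) = lam X + t * bump (lam X) (mu X) (nu X)"
  "mu (push t X) = mu X - 5 / 2 * (t * bump (lam X) (mu X) (nu X))"
  "nu (push t X) = nu X + 4 * (t * bump (lam X) (mu X) (nu X))"
  unfolding push_def coords_add by simp_all

lemma push_inj:
  assumes "0 \<le> t" "t \<le> 1"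
  shows "inj (push t)"
proof (rule injI)
  have *: "X = Y" if eq: "push t X = push t Y" and le: "lam X \<le> lam Y" for X Y
  proof -
    let ?a = "bump (lam X) (mu X) (nu X)" and ?b = "bump (lam Y) (mu Y) (nu Y)"
    have l: "lam X + t * ?a = lam Y + t * ?b"
      and m: "mu X - 5 / 2 * (t * ?a) = mu Y - 5 / 2 * (t * ?b)"
      and n: "nu X + 4 * (t * ?a) = nu Y + 4 * (t * ?b)"
      using eq coords_push by metis+
    have "?a - ?b \<le> 2 / 3 * (lam Y - lam X)"
      by (rule bump_slope) (use l m n le in linarith)+
    then have "t * (?a - ?b) \<le> t * (2 / 3 * (lam Y - lam X))"
      using assms(1) by (rule mult_left_mono)
    also have "\<dots> \<le> 1 * (2 / 3 * (lam Y - lam X))"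
      using assms(2) le by (intro mult_right_mono) auto
    finally have "t * ?a - t * ?b \<le> 2 / 3 * (lam Y - lam X)"
      by (simp add: algebra_simps)
    moreover have "t * ?a - t * ?b = lam Y - lam X"
      using l by simp
    ultimately have "lam Y \<le> lam X" by simp
    with le have "lam X = lam Y" by simp
    then show ?thesis
      using l m n by (intro pt_eqI) auto
  qed
  fix X Y assume "push t X = push t Y"
  then show "X = Y" using *[of X Y] *[of Y X] by fastforce
qed

lemma continuous_bump_comp [continuous_intros]:
  "continuous_on S f \<Longrightarrow> continuous_on S (\<lambda>x. bump (lam (f x)) (mu (f x)) (nu (f x)))"
  unfolding bump_def by (intro continuous_intros)

text \<open>
  The preimage of \<open>X\<close> lies on the line through \<open>X\<close> in the direction of the push.  As
  \<open>0 \<le> bump \<le> 1\<close>, the intermediate value theorem finds it at most one unit behind \<open>X\<close>.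
\<close>

lemma push_surj:
  assumes "0 \<le> t" "t \<le> 1"
  shows "surj (push t)"
proof -
  have "\<exists>Y. X = push t Y" for X
  proof -
    define Z where "Z \<theta> = pt (lam X + \<theta>) (mu X - 5 / 2 * \<theta>) (nu X + 4 * \<theta>)" for \<theta>
    define F where "F \<theta> = \<theta> + t * bump (lam (Z \<theta>)) (mu (Z \<theta>)) (nu (Z \<theta>))" for \<theta>
    have b: "0 \<le> t * bump a b c" "t * bump a b c \<le> 1" for a b c
      using assms bump_bounds[of a b c] by (auto intro: mult_le_one)
    have "F (-1) \<le> 0" "0 \<le> F 0"
      unfolding F_def using b by simp_all
    moreover have "continuous_on {-1..0} F"
      unfolding F_def Z_def by (intro continuous_intros)
    ultimately obtain \<theta> where "F \<theta> = 0"
      using IVT'[of F "-1" 0 0] by auto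
    then have "push t (Z \<theta>) = X"
      by (intro pt_eqI) (simp_all add: coords_push, simp_all add: F_def Z_def)
    then show ?thesis by metis
  qed
  then show ?thesis unfolding surj_def by blast
qed

lemma continuous_push:
  "continuous_on S f \<Longrightarrow> continuous_on S g \<Longrightarrow> continuous_on S (\<lambda>x. push (f x) (g x))"
  unfolding push_def by (intro continuous_intros)

text \<open>
  Continuity of the inverse comes from invariance of domain.
\<close>

lemma push_homeomorphism:
  assumes "0 \<le> t" "t \<le> 1"
  shows "\<exists>g. homeomorphism UNIV UNIV (push t) g"
  by (metis invariance_of_domain_homeomorphism[OF open_UNIV continuous_push[OF continuous_on_const continuous_on_id]
    order_refl push_inj[OF assms]] push_surj[OF assms])

lemma ambient_isotopic_push: "ambient_isotopic D (push 1 ` D)"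
  unfolding ambient_isotopic_def
proof (intro exI conjI)
  show "homotopic_with_canon (\<lambda>g. \<exists>g'. homeomorphism UNIV UNIV g g') UNIV UNIV id (push 1)"
    unfolding homotopic_with_def
  proof (rule exI, intro conjI ballI)
    show "continuous_map (prod_topology (top_of_set {0..1}) (top_of_set UNIV)) (top_of_set UNIV)
       (\<lambda>(t, X). push t X)"
      using continuous_push[OF continuous_on_fst[OF continuous_on_id] continuous_on_snd[OF continuous_on_id],
          of "{0..1} \<times> UNIV"]
      unfolding case_prod_unfold prod_topology_subtopology_eu
      by (simp add: continuous_map_iff_continuous)
    show "\<forall>X. (case (0, X) of (t, X) \<Rightarrow> push t X) = id X"
      by (simp add: push_def)
    show "\<forall>X. (case (1, X) of (t, X) \<Rightarrow> push t X) = push 1 X" by simp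
    show "\<exists>g'. homeomorphism UNIV UNIV (\<lambda>X. case (t, X) of (t, X) \<Rightarrow> push t X) g'"
      if "t \<in> {0..1}" for t
      using push_homeomorphism[of t] that by simp
  qed
qed simp

section \<open>Crossings of the diagram after the finger move\<close>

text \<open>
  The open segment of the under-strand that is moved.  Its end points \<open>(0, 1, 0)\<close> and \<open>(0, 2, 0)\<close> stay
  fixed and belong to \<open>finger\<close>.
\<close>

definition base :: "real^3 \<Rightarrow> bool" where
  "base X \<longleftrightarrow> lam X = 0 \<and> nu X = 0 \<and> 1 < mu X \<and> mu X < 2"

text \<open>
  The two closed edges from \<open>(0, 1, 0)\<close> and \<open>(0, 2, 0)\<close> to the apex \<open>(1, - 1, 4)\<close>.
\<close>

definition finger :: "real^3 \<Rightarrow> bool" where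
  "finger X \<longleftrightarrow> 0 \<le> lam X \<and> lam X \<le> 1 \<and> nu X = 4 * lam X \<and>
     (mu X = 1 - 2 * lam X \<or> mu X = 2 - 3 * lam X)"

abbreviation D' :: "(real^3) set" where "D' \<equiv> push 1 ` D"

lemma push_fixes:
  assumes "X \<in> D" "\<not> base X"
  shows "push 1 X = X"
proof -
  have "bump (lam X) (mu X) (nu X) = 0"
  proof (rule ccontr)
    assume *: "bump (lam X) (mu X) (nu X) \<noteq> 0"
    then have "mu X = 0 \<and> nu X = 1 \<or> lam X = 0 \<and> nu X = 0"
      using mem_box bump_support assms(1) by blast
    then show False
    proof
      assume "mu X = 0 \<and> nu X = 1"
      with * bump_over_line show False by simp
    next
      assume "lam X = 0 \<and> nu X = 0"
      with * bump_under_line assms(2) show False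
        by (auto simp: base_def max_def abs_if split: if_splits)
    qed
  qed
  then show ?thesis by (simp add: push_def)
qed

lemma push_base:
  assumes "base X"
  shows "lam (push 1 X) = 1 - \<bar>2 * mu X - 3\<bar>"
    "mu (push 1 X) = mu X - 5 / 2 * (1 - \<bar>2 * mu X - 3\<bar>)"
    "nu (push 1 X) = 4 * (1 - \<bar>2 * mu X - 3\<bar>)"
  using assms unfolding coords_push base_def by (auto simp: bump_under_line max_def abs_if)

lemma base_in_D: "base X \<Longrightarrow> X \<in> D"
  using mem_box[of X] by (auto simp: base_def)

lemma push_base_finger:
  assumes "base X"
  shows "finger (push 1 X)"
proof (cases "2 * mu X \<le> 3")
  case True
  then show ?thesis
    using assms unfolding finger_def push_base[OF assms] by (simp add: base_def field_simps)
next
  case False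
  then show ?thesis
    using assms unfolding finger_def push_base[OF assms] by (simp add: base_def field_simps)
qed

lemma finger_push_base:
  assumes "finger X" "0 < lam X"
  shows "\<exists>Y. base Y \<and> push 1 Y = X"
proof -
  \<comment> \<open>The affine inverse of the push on either half of the base.\<close>
  define m where "m = (if mu X = 1 - 2 * lam X then 1 + lam X / 2 else 2 - lam X / 2)"
  have "base (pt 0 m 0)"
    using assms by (auto simp: base_def m_def finger_def)
  moreover from this have "push 1 (pt 0 m 0) = X"
    using assms by (intro pt_eqI) (auto simp: push_base m_def finger_def abs_if)
  ultimately show ?thesis by blast
qed

lemma finger_box: "finger X \<Longrightarrow> \<bar>lam X\<bar> < 3 \<and> \<bar>mu X\<bar> < 3"
  by (auto simp: finger_def)

lemma finger_in_D_iff: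
  assumes "finger X"
  shows "X \<in> D \<longleftrightarrow> lam X = 0"
proof -
  have "X \<in> D \<longleftrightarrow> mu X = 0 \<and> nu X = 1 \<or> lam X = 0 \<and> nu X = 0"
    using finger_box[OF assms] by (intro mem_box) auto
  then show ?thesis using assms by (auto simp: finger_def)
qed

lemma mem_D'_iff: "X \<in> D' \<longleftrightarrow> X \<in> D \<and> \<not> base X \<or> finger X"
proof
  assume "X \<in> D'"
  then obtain Y where "Y \<in> D" "X = push 1 Y" by blast
  then show "X \<in> D \<and> \<not> base X \<or> finger X"
    using push_fixes push_base_finger by metis
next
  assume "X \<in> D \<and> \<not> base X \<or> finger X"
  then show "X \<in> D'"
  proof
    assume "X \<in> D \<and> \<not> base X"
    then show ?thesis using push_fixes by (metis imageI)
  next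
    assume f: "finger X"
    show ?thesis
    proof (cases "lam X = 0")
      case True
      then have "X \<in> D" "\<not> base X" using f finger_in_D_iff by (auto simp: finger_def base_def)
      then show ?thesis using push_fixes by (metis imageI)
    next
      case False
      then have "0 < lam X" using f by (simp add: finger_def)
      then show ?thesis using finger_push_base[OF f] base_in_D by blast
    qed
  qed
qed

text \<open>
  The projections of the two edges of the finger meet the over-strand at \<open>l = 1 / 2\<close> and \<open>l = 2 / 3\<close>.
  There the finger has height \<open>4 l > 1\<close> and passes over.
\<close>

definition new_crossing :: "real^3 \<Rightarrow> real^3 \<Rightarrow> bool" where
  "new_crossing X Y \<longleftrightarrow> lam X = lam Y \<and> mu X = 0 \<and> mu Y = 0 \<and> nu Y = 1 \<and>
     (lam X = 1 / 2 \<and> nu X = 2 \<or> lam X = 2 / 3 \<and> nu X = 8 / 3)"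

lemma base_box: "base X \<Longrightarrow> \<bar>lam X\<bar> < 3 \<and> \<bar>mu X\<bar> < 3"
  by (auto simp: base_def)

lemma mem_D'_box: "\<bar>lam X\<bar> < 3 \<Longrightarrow> \<bar>mu X\<bar> < 3 \<Longrightarrow>
    X \<in> D' \<longleftrightarrow> mu X = 0 \<and> nu X = 1 \<or> lam X = 0 \<and> nu X = 0 \<and> \<not> (1 < mu X \<and> mu X < 2) \<or> finger X"
  unfolding mem_D'_iff using mem_box[of X] by (auto simp: base_def)

lemma not_crossing_base: "crossing D X Y \<Longrightarrow> \<not> base X \<and> \<not> base Y"
  using base_box[of X] base_box[of Y] mem_box[of X] mem_box[of Y]
  unfolding crossing_iff by (auto simp: base_def)

lemma not_crossing_finger: "crossing D X Y \<Longrightarrow> \<not> finger X \<and> \<not> finger Y"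
  using finger_box[of X] finger_box[of Y] mem_box[of X] mem_box[of Y]
  unfolding crossing_iff by (auto simp: finger_def)

text \<open>
  In projection the finger leaves the under-strand at once and its two edges share only the apex, so
  that vertically above or below it there can only be the over-strand.
\<close>

lemma over_finger:
  assumes "finger X" "Y \<in> D'" "lam X = lam Y" "mu X = mu Y"
  shows "X = Y \<or> new_crossing X Y"
proof -
  have "\<bar>lam Y\<bar> < 3" "\<bar>mu Y\<bar> < 3" using finger_box[OF assms(1)] assms(3,4) by auto
  from mem_D'_box[OF this] assms(2)
  consider "mu Y = 0 \<and> nu Y = 1" | "lam Y = 0 \<and> nu Y = 0 \<and> \<not> (1 < mu Y \<and> mu Y < 2)" | "finger Y"
    by blast
  then show ?thesis
  proof cases
    case 1
    then show ?thesis using assms by (auto simp: finger_def new_crossing_def)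
  next
    case 2
    then have "X = Y" using assms by (intro pt_eqI) (auto simp: finger_def)
    then show ?thesis ..
  next
    case 3
    then have "X = Y" using assms by (intro pt_eqI) (auto simp: finger_def)
    then show ?thesis ..
  qed
qed

lemma new_crossing_finger: "new_crossing X Y \<Longrightarrow> finger X \<and> \<not> finger Y \<and> Y \<in> D \<and> \<not> base Y"
  using mem_box[of Y] by (auto simp: new_crossing_def finger_def base_def)

lemma crossing_D'_iff: "crossing D' X Y \<longleftrightarrow> crossing D X Y \<or> new_crossing X Y"
proof
  assume c: "crossing D' X Y"
  then have *: "X \<in> D'" "Y \<in> D'" "lam X = lam Y" "mu X = mu Y" "nu Y < nu X"
    by (auto simp: crossing_iff)
  show "crossing D X Y \<or> new_crossing X Y"
  proof (cases "finger X \<or> finger Y")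
    case True
    then show ?thesis
    proof
      assume "finger X"
      then show ?thesis using over_finger[of X Y] * by auto
    next
      assume "finger Y"
      then have "Y = X \<or> new_crossing Y X" using over_finger[of Y X] * by auto
      then show ?thesis using *(5) by (auto simp: new_crossing_def)
    qed
  next
    case False
    with * have "X \<in> D" "Y \<in> D" by (auto simp: mem_D'_iff)
    with * show ?thesis by (simp add: crossing_iff)
  qed
next
  assume "crossing D X Y \<or> new_crossing X Y"
  then show "crossing D' X Y"
  proof
    assume c: "crossing D X Y"
    with not_crossing_base[OF c] show ?thesis
      unfolding crossing_iff mem_D'_iff by blast
  next
    assume n: "new_crossing X Y"
    with new_crossing_finger[OF n] show ?thesis
      unfolding crossing_iff mem_D'_iff by (auto simp: new_crossing_def)
  qed
qed

lemma no_triple_points: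
  assumes "X \<in> D'" "Y \<in> D'" "Z \<in> D'" "proj X = proj Y" "proj Y = proj Z"
  shows "X = Y \<or> Y = Z \<or> X = Z"
proof -
  have fin: "A = B \<or> B = C \<or> A = C"
    if "finger A" "B \<in> D'" "C \<in> D'" "proj A = proj B" "proj B = proj C" for A B C
  proof -
    have "A = B \<or> new_crossing A B" "A = C \<or> new_crossing A C"
      using over_finger that by (auto simp: proj_eq_iff)
    moreover have "B = C" if "new_crossing A B" "new_crossing A C"
      using that by (intro pt_eqI) (auto simp: new_crossing_def)
    ultimately show ?thesis by blast
  qed
  show ?thesis
  proof (cases "finger X \<or> finger Y \<or> finger Z")
    case True
    then show ?thesis
      using fin[of X Y Z] fin[of Y X Z] fin[of Z X Y] assms by metis
  next
    case False
    then have "X \<in> D" "Y \<in> D" "Z \<in> D" using assms by (auto simp: mem_D'_iff)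
    then show ?thesis
      using diagram assms(4,5) unfolding diagram_def by blast
  qed
qed

text \<open>
  An open set on which the diagram is not changed by the move.  It contains all old crossings, so that
  their local properties carry over.
\<close>

definition fixed_region :: "(real^3) set" where
  "fixed_region = - ({X. finger X} \<union> {X. lam X = 0 \<and> nu X = 0 \<and> 1 \<le> mu X \<and> mu X \<le> 2})"

text \<open>
  The end points of the base, which make the removed set closed, are also end points of the finger.
\<close>

lemma mem_fixed_region: "X \<in> fixed_region \<longleftrightarrow> \<not> finger X \<and> \<not> base X"
  unfolding fixed_region_def base_def finger_def by auto

lemma open_fixed_region: "open fixed_region"
proof -
  have "closed {X. finger X}"
    unfolding finger_def
    by (intro closed_Collect_conj closed_Collect_disj closed_Collect_le closed_Collect_eq continuous_intros)
  moreover have "closed {X. lam X = 0 \<and> nu X = 0 \<and> 1 \<le> mu X \<and> mu X \<le> 2}"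
    by (intro closed_Collect_conj closed_Collect_le closed_Collect_eq continuous_intros)
  ultimately show ?thesis
    unfolding fixed_region_def by (intro open_Compl closed_Un)
qed

lemma D'_fixed_region: "D \<inter> fixed_region = D' \<inter> fixed_region"
  unfolding set_eq_iff Int_iff mem_D'_iff mem_fixed_region by blast

lemma crossing_fixed_region: "crossing D X Y \<Longrightarrow> X \<in> fixed_region \<and> Y \<in> fixed_region"
  unfolding mem_fixed_region using not_crossing_base not_crossing_finger by blast

lemma line_iff: "Y \<in> range (\<lambda>t. X + t *\<^sub>R (a *\<^sub>R u + b *\<^sub>R v + c *\<^sub>R k)) \<longleftrightarrow>
    (\<exists>t. lam Y = lam X + t * a \<and> mu Y = mu X + t * b \<and> nu Y = nu X + t * c)"
proof -
  have *: "X + t *\<^sub>R (a *\<^sub>R u + b *\<^sub>R v + c *\<^sub>R k) = X + ((t * a) *\<^sub>R u + (t * b) *\<^sub>R v + (t * c) *\<^sub>R k)" for t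
    by (simp add: algebra_simps)
  show ?thesis
    unfolding * image_iff using coords_add pt_eqI by (metis UNIV_I)
qed

lemma new_crossing_straight:
  assumes "new_crossing X Y"
  shows "\<exists>b. straight_at D' X (1 *\<^sub>R u + b *\<^sub>R v + 4 *\<^sub>R k) \<and> b \<noteq> 0"
    and "straight_at D' Y (1 *\<^sub>R u + 0 *\<^sub>R v + 0 *\<^sub>R k)"
proof -
  \<comment> \<open>The edges of the finger have the directions \<open>(1, - 2, 4)\<close> and \<open>(1, - 3, 4)\<close>.\<close>
  define b :: real where "b = (if lam X = 1 / 2 then -2 else -3)"
  have "straight_at D' X (1 *\<^sub>R u + b *\<^sub>R v + 4 *\<^sub>R k)"
  proof (rule straight_atI)
    let ?W = "{Z. 1 / 4 < lam Z \<and> lam Z < 3 / 4 \<and> - (1 / 10) < mu Z \<and> mu Z < 1 / 10 \<and> 3 / 2 < nu Z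
       \<and> \<bar>lam Z - lam X\<bar> < 1 / 50}"
    show "open ?W"
      by (intro open_Collect_conj open_Collect_less continuous_intros)
    show "X \<in> ?W" using assms by (auto simp: new_crossing_def)
    define L where "L = range (\<lambda>t. X + t *\<^sub>R (1 *\<^sub>R u + b *\<^sub>R v + 4 *\<^sub>R k))"
    show "D' \<inter> ?W = range (\<lambda>t. X + t *\<^sub>R (1 *\<^sub>R u + b *\<^sub>R v + 4 *\<^sub>R k)) \<inter> ?W"
    proof (intro set_eqI, fold L_def)
      fix Z
      have "Z \<in> D' \<longleftrightarrow> Z \<in> L" if "Z \<in> ?W"
      proof -
        have box: "\<bar>lam Z\<bar> < 3" "\<bar>mu Z\<bar> < 3" using that by auto
        have line: "Z \<in> L \<longleftrightarrow>
            mu Z = b * (lam Z - lam X) \<and> nu Z = nu X + 4 * (lam Z - lam X)"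
          unfolding L_def line_iff using assms by (auto simp: new_crossing_def intro!: exI[of _ "lam Z - lam X"])
        show ?thesis
          unfolding line mem_D'_box[OF box] finger_def b_def
          using that assms by (auto simp: new_crossing_def abs_if split: if_splits)
      qed
      then show "Z \<in> D' \<inter> ?W \<longleftrightarrow> Z \<in> L \<inter> ?W"
        by blast
    qed
  qed
  then show "\<exists>b. straight_at D' X (1 *\<^sub>R u + b *\<^sub>R v + 4 *\<^sub>R k) \<and> b \<noteq> 0"
    by (intro exI[of _ b]) (simp add: b_def)
  show "straight_at D' Y (1 *\<^sub>R u + 0 *\<^sub>R v + 0 *\<^sub>R k)"
  proof (rule straight_atI)
    let ?W = "{Z. 2 / 5 < lam Z \<and> lam Z < 1 \<and> -1 < mu Z \<and> mu Z < 1 \<and> nu Z < 3 / 2}"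
    show "open ?W"
      by (intro open_Collect_conj open_Collect_less continuous_intros)
    show "Y \<in> ?W" using assms by (auto simp: new_crossing_def)
    define L where "L = range (\<lambda>t. Y + t *\<^sub>R (1 *\<^sub>R u + 0 *\<^sub>R v + 0 *\<^sub>R k))"
    show "D' \<inter> ?W = range (\<lambda>t. Y + t *\<^sub>R (1 *\<^sub>R u + 0 *\<^sub>R v + 0 *\<^sub>R k)) \<inter> ?W"
    proof (intro set_eqI, fold L_def)
      fix Z
      have "Z \<in> D' \<longleftrightarrow> Z \<in> L" if "Z \<in> ?W"
      proof -
        have box: "\<bar>lam Z\<bar> < 3" "\<bar>mu Z\<bar> < 3" using that by auto
        have line: "Z \<in> L \<longleftrightarrow> mu Z = 0 \<and> nu Z = 1"
          unfolding L_def line_iff using assms by (auto simp: new_crossing_def intro!: exI[of _ "lam Z - lam Y"])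
        show ?thesis
          unfolding line mem_D'_box[OF box] finger_def using that by auto
      qed
      then show "Z \<in> D' \<inter> ?W \<longleftrightarrow> Z \<in> L \<inter> ?W"
        by blast
    qed
  qed
qed

end

section \<open>The finger move yields a diagram\<close>

lemma convex_affine_le:
  fixes f :: "'a::real_vector \<Rightarrow> real"
  assumes "\<And>a b x y. a + b = 1 \<Longrightarrow> f (a *\<^sub>R x + b *\<^sub>R y) = a * f x + b * f y"
  shows "convex {x. f x \<le> c}"
  by (rule convexI) (simp add: assms convex_bound_le)

lemma convex_affine_ge:
  fixes f :: "'a::real_vector \<Rightarrow> real"
  assumes "\<And>a b x y. a + b = 1 \<Longrightarrow> f (a *\<^sub>R x + b *\<^sub>R y) = a * f x + b * f y"
  shows "convex {x. c \<le> f x}"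
  using convex_affine_le[of "\<lambda>x. - f x" "- c"] by (simp add: assms)

context crossing_chart
begin

lemma pt_convex_combination:
  assumes "a + b = 1"
  shows "a *\<^sub>R pt l m n + b *\<^sub>R pt l' m' n' = pt (a * l + b * l') (a * m + b * m') (a * n + b * n')"
proof -
  have "orig = (a + b) *\<^sub>R orig" using assms by simp
  then show ?thesis
    unfolding pt_def by (simp add: algebra_simps)
qed

lemma coords_convex_combination:
  assumes "a + b = 1"
  shows "lam (a *\<^sub>R X + b *\<^sub>R Y) = a * lam X + b * lam Y"
    "mu (a *\<^sub>R X + b *\<^sub>R Y) = a * mu X + b * mu Y"
    "nu (a *\<^sub>R X + b *\<^sub>R Y) = a * nu X + b * nu Y"
  using pt_convex_combination[OF assms, of "lam X" "mu X" "nu X" "lam Y" "mu Y" "nu Y"]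
  by simp_all

lemma closed_segment_pt_iff:
  "X \<in> closed_segment (pt l m n) (pt l' m' n') \<longleftrightarrow>
     (\<exists>t. 0 \<le> t \<and> t \<le> 1 \<and> lam X = (1 - t) * l + t * l' \<and> mu X = (1 - t) * m + t * m' \<and>
        nu X = (1 - t) * n + t * n')"
proof -
  have "X \<in> closed_segment (pt l m n) (pt l' m' n') \<longleftrightarrow>
     (\<exists>t. 0 \<le> t \<and> t \<le> 1 \<and> X = pt ((1 - t) * l + t * l') ((1 - t) * m + t * m') ((1 - t) * n + t * n'))"
    by (simp add: in_segment pt_convex_combination)
  moreover have "X = pt l m n \<longleftrightarrow> lam X = l \<and> mu X = m \<and> nu X = n" for l m n
    using pt_coords[of X] by auto
  ultimately show ?thesis by simp
qed

lemma finger_segments: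
  "{X. finger X} = closed_segment (pt 0 1 0) (pt 1 (-1) 4) \<union> closed_segment (pt 0 2 0) (pt 1 (-1) 4)"
proof (intro set_eqI)
  fix X
  have "X \<in> closed_segment (pt 0 1 0) (pt 1 (-1) 4) \<longleftrightarrow>
      0 \<le> lam X \<and> lam X \<le> 1 \<and> nu X = 4 * lam X \<and> mu X = 1 - 2 * lam X"
    unfolding closed_segment_pt_iff by auto
  moreover have "X \<in> closed_segment (pt 0 2 0) (pt 1 (-1) 4) \<longleftrightarrow>
      0 \<le> lam X \<and> lam X \<le> 1 \<and> nu X = 4 * lam X \<and> mu X = 2 - 3 * lam X"
    unfolding closed_segment_pt_iff by auto
  ultimately show "X \<in> {X. finger X} \<longleftrightarrow>
      X \<in> closed_segment (pt 0 1 0) (pt 1 (-1) 4) \<union> closed_segment (pt 0 2 0) (pt 1 (-1) 4)"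
    unfolding finger_def by blast
qed

text \<open>
  The base is cut out of \<open>D\<close> by an open vertical prism, whose complement consists of four half-spaces;
  the two edges of the finger are then added.
\<close>

lemma polygonal_D': "polygonal D'"
proof -
  have cv: "convex {X. lam X \<le> -1}" "convex {X. lam X \<ge> 1}" "convex {X. mu X \<le> 1}" "convex {X. mu X \<ge> 2}"
    by (intro convex_affine_le convex_affine_ge, simp add: coords_convex_combination)+
  have cl: "closed {X. lam X \<le> -1}" "closed {X. lam X \<ge> 1}" "closed {X. mu X \<le> 1}" "closed {X. mu X \<ge> 2}"
    by (intro closed_Collect_le continuous_intros)+
  have "D' = (D \<inter> {X. lam X \<le> -1}) \<union> (D \<inter> {X. lam X \<ge> 1}) \<union> (D \<inter> {X. mu X \<le> 1})
      \<union> (D \<inter> {X. mu X \<ge> 2}) \<union> {X. finger X}" (is "_ = ?R")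
  proof (intro set_eqI)
    fix X
    have "base X \<longleftrightarrow> \<not> (lam X \<le> -1 \<or> lam X \<ge> 1 \<or> mu X \<le> 1 \<or> mu X \<ge> 2)" if "X \<in> D"
      using mem_box[of X] that by (auto simp: base_def)
    then show "X \<in> D' \<longleftrightarrow> X \<in> ?R"
      unfolding mem_D'_iff Un_iff Int_iff mem_Collect_eq by blast
  qed
  moreover have "polygonal ?R"
    unfolding finger_segments using diagram cv cl
    by (intro polygonal_Un polygonal_Int_closed_convex polygonal_closed_segment) (auto simp: diagram_def)
  ultimately show ?thesis by simp
qed

lemma is_link_D': "is_link D'"
proof -
  obtain g where "homeomorphism UNIV UNIV (push 1) g"
    using push_homeomorphism[of 1] by auto
  then have "homeomorphism D D' (push 1) g"
    by (rule homeomorphism_of_subsets) auto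
  then show ?thesis
    using is_link_homeomorphic_image polygonal_D' diagram by (auto simp: diagram_def)
qed

lemma diagram_D': "diagram D'"
proof -
  have "{(X, Y). crossing D' X Y} \<subseteq> {(X, Y). crossing D X Y} \<union>
      {(pt (1 / 2) 0 2, pt (1 / 2) 0 1), (pt (2 / 3) 0 (8 / 3), pt (2 / 3) 0 1)}"
    unfolding crossing_D'_iff by (auto simp: new_crossing_def intro!: pt_eqI)
  moreover have "finite {(X, Y). crossing D X Y}"
    using diagram by (simp add: diagram_def)
  ultimately have "finite {(X, Y). crossing D' X Y}"
    using finite_subset by blast
  moreover have "\<exists>a b. straight_at D' X a \<and> straight_at D' Y b \<and> a $ 1 * b $ 2 \<noteq> a $ 2 * b $ 1"
    if "crossing D' X Y" for X Y
  proof (cases "crossing D X Y")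
    case True
    then obtain a b where "straight_at D X a" "straight_at D Y b" "a $ 1 * b $ 2 \<noteq> a $ 2 * b $ 1"
      using diagram unfolding diagram_def by blast
    then show ?thesis
      using straight_at_localized[OF _ open_fixed_region _ D'_fixed_region] crossing_fixed_region[OF True]
      by blast
  next
    case False
    then have n: "new_crossing X Y" using that crossing_D'_iff by blast
    obtain b where b: "straight_at D' X (1 *\<^sub>R u + b *\<^sub>R v + 4 *\<^sub>R k)" "b \<noteq> 0"
      using new_crossing_straight(1)[OF n] by blast
    have "(1 *\<^sub>R u + b *\<^sub>R v + 4 *\<^sub>R k) $ 1 * (1 *\<^sub>R u + 0 *\<^sub>R v + 0 *\<^sub>R k) $ 2 -
        (1 *\<^sub>R u + b *\<^sub>R v + 4 *\<^sub>R k) $ 2 * (1 *\<^sub>R u + 0 *\<^sub>R v + 0 *\<^sub>R k) $ 1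
      = b * (u $ 2 * v $ 1 - u $ 1 * v $ 2)"
      using vertical by (simp add: algebra_simps)
    also have "\<dots> \<noteq> 0" using b(2) transversal by simp
    finally show ?thesis
      using b(1) new_crossing_straight(2)[OF n] by (metis right_minus_eq)
  qed
  ultimately show ?thesis
    unfolding diagram_def using is_link_D' polygonal_D' no_triple_points by blast
qed

section \<open>Colors near the crossing\<close>

lemma crossing_center: "crossing D (pt 0 0 1) (pt 0 0 0)"
  unfolding crossing_iff using mem_box[of "pt 0 0 1"] mem_box[of "pt 0 0 0"] by simp

lemma over_line_regular: "\<bar>l\<bar> < 3 \<Longrightarrow> pt l 0 1 \<in> regular_part D"
proof -
  assume l: "\<bar>l\<bar> < 3"
  have "\<not> crossing D Z (pt l 0 1)" for Z
    using mem_box[of Z] l by (auto simp: crossing_iff)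
  then show ?thesis
    using mem_box[of "pt l 0 1"] l by (auto simp: regular_part_def under_points_def)
qed

lemma under_line_regular: "\<bar>m\<bar> < 3 \<Longrightarrow> m \<noteq> 0 \<Longrightarrow> pt 0 m 0 \<in> regular_part D"
proof -
  assume m: "\<bar>m\<bar> < 3" "m \<noteq> 0"
  have "\<not> crossing D Z (pt 0 m 0)" for Z
    using mem_box[of Z] m by (auto simp: crossing_iff)
  then show ?thesis
    using mem_box[of "pt 0 m 0"] m by (auto simp: regular_part_def under_points_def)
qed

lemma connected_component_regularI:
  assumes "connected I" "s \<in> I" "t \<in> I" "continuous_on I f" "f ` I \<subseteq> regular_part D"
  shows "connected_component (regular_part D) (f s) (f t)"
  unfolding connected_component_def using assms by (meson connected_continuous_image imageI)

lemma over_line_color: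
  assumes "point_coloring p D \<gamma>" "\<bar>l\<bar> < 3"
  shows "\<gamma> (pt l 0 1) = \<gamma> (pt 0 0 1)"
proof -
  have "connected_component (regular_part D) (pt l 0 1) (pt 0 0 1)"
    by (rule connected_component_regularI[of "{-3<..<3}" _ _ "\<lambda>l. pt l 0 1"])
      (use assms(2) over_line_regular in \<open>auto intro!: continuous_intros\<close>)
  then show ?thesis using assms(1) unfolding point_coloring_def by blast
qed

lemma under_line_color:
  assumes "point_coloring p D \<gamma>"
  shows "0 < m \<Longrightarrow> m < 3 \<Longrightarrow> \<gamma> (pt 0 m 0) = \<gamma> (pt 0 1 0)"
    and "-3 < m \<Longrightarrow> m < 0 \<Longrightarrow> \<gamma> (pt 0 m 0) = \<gamma> (pt 0 (-1) 0)"
proof -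
  assume "0 < m" "m < 3"
  then have "connected_component (regular_part D) (pt 0 m 0) (pt 0 1 0)"
    by (intro connected_component_regularI[of "{0<..<3}" _ _ "\<lambda>m. pt 0 m 0"])
      (use under_line_regular in \<open>auto intro!: continuous_intros\<close>)
  then show "\<gamma> (pt 0 m 0) = \<gamma> (pt 0 1 0)" using assms unfolding point_coloring_def by blast
next
  assume "-3 < m" "m < 0"
  then have "connected_component (regular_part D) (pt 0 m 0) (pt 0 (-1) 0)"
    by (intro connected_component_regularI[of "{-3<..<0}" _ _ "\<lambda>m. pt 0 m 0"])
      (use under_line_regular in \<open>auto intro!: continuous_intros\<close>)
  then show "\<gamma> (pt 0 m 0) = \<gamma> (pt 0 (-1) 0)" using assms unfolding point_coloring_def by blast
qed

lemma pt_shift_near: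
  assumes "e > 0" "\<delta> > 0"
  obtains t where "0 < t" "t < \<delta>" "pt (l + t * a) (m + t * b) n \<in> ball (pt l m n) e"
    "pt (l - t * a) (m - t * b) n \<in> ball (pt l m n) e"
proof -
  define w where "w = a *\<^sub>R u + b *\<^sub>R v"
  define t where "t = min (\<delta> / 2) (e / (2 * (1 + norm w)))"
  have "0 < 1 + norm w" by (smt (verit) norm_ge_zero)
  then have t: "0 < t" "t < \<delta>" "t \<le> e / (2 * (1 + norm w))"
    using assms by (auto simp: t_def)
  have "t * norm w \<le> t * (1 + norm w)" using t(1) by simp
  also have "\<dots> \<le> e / 2"
    using t(3) \<open>0 < 1 + norm w\<close> by (simp add: field_simps)
  also have "\<dots> < e" using assms by simp
  finally have "t * norm w < e" .
  moreover have "pt l m n - pt (l + t * a) (m + t * b) n = (- t) *\<^sub>R w"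
    "pt l m n - pt (l - t * a) (m - t * b) n = t *\<^sub>R w"
    by (simp_all add: pt_def w_def algebra_simps)
  ultimately show thesis
    using that[of t] t(1,2) by (simp add: dist_norm)
qed

end

lemma colors_nearI:
  assumes "open W" "y \<in> W" "\<And>z. z \<in> regular_part D \<Longrightarrow> z \<in> W \<Longrightarrow> \<gamma> z \<in> S"
    and "\<And>s e. s \<in> S \<Longrightarrow> e > 0 \<Longrightarrow> \<exists>z\<in>regular_part D \<inter> ball y e. \<gamma> z = s"
  shows "colors_near D \<gamma> y S"
proof -
  obtain r where r: "r > 0" "ball y r \<subseteq> W"
    using assms(1,2) open_contains_ball by blast
  have "\<gamma> ` (regular_part D \<inter> ball y e) = S" if "0 < e" "e < r" for e
  proof -
    have "ball y e \<subseteq> W" using that r(2) by fastforce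
    then show ?thesis using assms(3,4) that(1) by blast
  qed
  then show ?thesis
    unfolding colors_near_def eventually_at_right_field using r(1) by (intro exI[of _ r]) auto
qed

context crossing_chart
begin

section \<open>The coloring after the finger move\<close>

text \<open>
  The piece of the over-strand between the two new under-points, which is covered by the finger.
\<close>

definition tip :: "real^3 \<Rightarrow> bool" where
  "tip X \<longleftrightarrow> 1 / 2 < lam X \<and> lam X < 2 / 3 \<and> mu X = 0 \<and> nu X = 1"

definition pull :: "real^3 \<Rightarrow> real^3" where
  "pull = inv (push 1)"

definition finger_coloring :: "(real^3 \<Rightarrow> int) \<Rightarrow> int \<Rightarrow> real^3 \<Rightarrow> int" where
  "finger_coloring \<gamma> e X = (if tip X then e else \<gamma> (pull X))"

lemma pull_push [simp]: "pull (push 1 X) = X"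
  unfolding pull_def by (rule inv_f_f[OF push_inj]) auto

lemma pull_fixes: "X \<in> D \<Longrightarrow> \<not> base X \<Longrightarrow> pull X = X"
  using push_fixes pull_push by metis

lemma continuous_pull: "continuous_on S pull"
proof -
  obtain g where g: "homeomorphism UNIV UNIV (push 1) g"
    using push_homeomorphism[of 1] by auto
  have "g X = pull X" for X
    using g pull_push[of "g X"] by (simp add: homeomorphism_def)
  then have "g = pull" by blast
  with g show ?thesis
    unfolding homeomorphism_def using continuous_on_subset by blast
qed

lemma under_points_D'_iff:
  "Y \<in> under_points D' \<longleftrightarrow>
     Y \<in> under_points D \<or> mu Y = 0 \<and> nu Y = 1 \<and> (lam Y = 1 / 2 \<or> lam Y = 2 / 3)"
proof -
  have "(\<exists>X. new_crossing X Y) \<longleftrightarrow> mu Y = 0 \<and> nu Y = 1 \<and> (lam Y = 1 / 2 \<or> lam Y = 2 / 3)"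
  proof
    assume "mu Y = 0 \<and> nu Y = 1 \<and> (lam Y = 1 / 2 \<or> lam Y = 2 / 3)"
    then have "new_crossing (pt (lam Y) 0 (if lam Y = 1 / 2 then 2 else 8 / 3)) Y"
      by (auto simp: new_crossing_def)
    then show "\<exists>X. new_crossing X Y" ..
  qed (auto simp: new_crossing_def)
  then show ?thesis
    unfolding under_points_def mem_Collect_eq crossing_D'_iff by blast
qed

lemma regular_part_over_line:
  assumes "X \<in> D'" "\<bar>lam X\<bar> < 3" "mu X = 0" "nu X = 1" "lam X \<noteq> 1 / 2" "lam X \<noteq> 2 / 3"
  shows "X \<in> regular_part D'"
proof -
  have "X = pt (lam X) 0 1" using assms by (intro pt_eqI) auto
  then have "X \<in> regular_part D" using over_line_regular assms(2) by metis
  then show ?thesis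
    using assms by (auto simp: regular_part_def under_points_D'_iff)
qed

lemma over_line_in_D': "\<bar>l\<bar> < 3 \<Longrightarrow> pt l 0 1 \<in> D'"
  by (subst mem_D'_box) auto

lemma tip_not_base: "tip X \<Longrightarrow> X \<in> D \<and> \<not> base X"
  using mem_box[of X] by (auto simp: tip_def base_def)

lemma pull_regular:
  assumes "X \<in> regular_part D'"
  shows "pull X \<in> regular_part D"
proof -
  obtain Y where Y: "Y \<in> D" "X = push 1 Y" using assms by (auto simp: regular_part_def)
  have "Y \<notin> under_points D"
  proof
    assume *: "Y \<in> under_points D"
    then have "\<not> base Y" using not_crossing_base by (auto simp: under_points_def)
    then have "X = Y" using Y push_fixes by simp
    with * assms show False by (simp add: regular_part_def under_points_D'_iff)
  qed
  with Y show ?thesis by (simp add: regular_part_def)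
qed

text \<open>
  The tip is open and closed in the regular part: its end points are the two new under-points, and the
  edges of the finger pass it at a distance, at height at least \<open>2\<close>.  So it is one of the new arcs.
\<close>

lemma connected_tip:
  assumes "connected S" "S \<subseteq> regular_part D'" "X \<in> S" "Y \<in> S" "tip X"
  shows "tip Y"
proof -
  let ?O = "{Z. 1 / 2 < lam Z \<and> lam Z < 2 / 3 \<and> -1 < mu Z \<and> mu Z < 1 \<and> nu Z < 3 / 2}"
  let ?C = "{Z. 1 / 2 \<le> lam Z \<and> lam Z \<le> 2 / 3 \<and> -1 \<le> mu Z \<and> mu Z \<le> 1 \<and> nu Z \<le> 3 / 2}"
  have "open ?O" by (intro open_Collect_conj open_Collect_less continuous_intros)
  have "closed ?C" by (intro closed_Collect_conj closed_Collect_le continuous_intros)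
  have sep: "tip Z \<longleftrightarrow> Z \<in> ?O" "tip Z \<longleftrightarrow> Z \<in> ?C" if "Z \<in> S" for Z
  proof -
    have "Z \<in> regular_part D'" using that assms(2) by blast
    then have Z: "Z \<in> D'" "\<not> (mu Z = 0 \<and> nu Z = 1 \<and> (lam Z = 1 / 2 \<or> lam Z = 2 / 3))"
      by (auto simp: regular_part_def under_points_D'_iff)
    have "tip Z" if "Z \<in> ?C"
    proof -
      have "\<bar>lam Z\<bar> < 3" "\<bar>mu Z\<bar> < 3" using that by auto
      from mem_D'_box[OF this] Z that show ?thesis
        by (auto simp: tip_def finger_def)
    qed
    moreover have "Z \<in> ?O" if "tip Z" using that by (auto simp: tip_def)
    moreover have "?O \<subseteq> ?C" by auto
    ultimately show "tip Z \<longleftrightarrow> Z \<in> ?O" "tip Z \<longleftrightarrow> Z \<in> ?C" by blast+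
  qed
  show ?thesis
  proof (rule ccontr)
    assume "\<not> tip Y"
    then have "Y \<in> - ?C \<inter> S" using sep(2)[OF assms(4)] assms(4) by blast
    moreover have "X \<in> ?O \<inter> S" using sep(1)[OF assms(3)] assms(3,5) by blast
    moreover have "S \<subseteq> ?O \<union> - ?C" using sep by blast
    moreover have "?O \<inter> - ?C \<inter> S = {}" by auto
    moreover have "open (- ?C)" using \<open>closed ?C\<close> by (rule open_Compl)
    ultimately show False
      using connectedD[OF assms(1) \<open>open ?O\<close>, of "- ?C"] by blast
  qed
qed

lemma colors_near_center:
  assumes "point_coloring p D \<gamma>"
  shows "colors_near D \<gamma> (pt 0 0 0) {\<gamma> (pt 0 1 0), \<gamma> (pt 0 (-1) 0)}"
proof (rule colors_nearI)
  let ?W = "{Z. -1 < lam Z \<and> lam Z < 1 \<and> -1 < mu Z \<and> mu Z < 1 \<and> nu Z < 1 / 2}"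
  show "open ?W" by (intro open_Collect_conj open_Collect_less continuous_intros)
  show "pt 0 0 0 \<in> ?W" by simp
  show "\<gamma> Z \<in> {\<gamma> (pt 0 1 0), \<gamma> (pt 0 (-1) 0)}" if "Z \<in> regular_part D" "Z \<in> ?W" for Z
  proof -
    have "Z \<in> D" using that(1) by (simp add: regular_part_def)
    then have "lam Z = 0" "nu Z = 0" using mem_box[of Z] that(2) by auto
    then have Z: "Z = pt 0 (mu Z) 0" by (intro pt_eqI) auto
    have "pt 0 0 0 \<notin> regular_part D"
      using crossing_center by (auto simp: regular_part_def under_points_def)
    then have "mu Z \<noteq> 0" using Z that(1) by metis
    then have "mu Z < 0 \<or> 0 < mu Z" by linarith
    then have "\<gamma> (pt 0 (mu Z) 0) \<in> {\<gamma> (pt 0 1 0), \<gamma> (pt 0 (-1) 0)}"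
      using under_line_color[OF assms, of "mu Z"] that(2) by (elim disjE) simp_all
    with Z show ?thesis by simp
  qed
  show "\<exists>Z\<in>regular_part D \<inter> ball (pt 0 0 0) e. \<gamma> Z = s"
    if s: "s \<in> {\<gamma> (pt 0 1 0), \<gamma> (pt 0 (-1) 0)}" and e: "e > 0" for s e
  proof -
    obtain t where t: "0 < t" "t < 3" "pt 0 t 0 \<in> ball (pt 0 0 0) e" "pt 0 (- t) 0 \<in> ball (pt 0 0 0) e"
      using pt_shift_near[OF e, of 3 0 0 0 1 0] by auto
    then show ?thesis
      using s under_line_color[OF assms, of t] under_line_color[OF assms, of "- t"]
        under_line_regular[of t] under_line_regular[of "- t"] by auto
  qed
qed

lemma finger_coloring_over_line:
  assumes "point_coloring p D \<gamma>" "\<bar>l\<bar> < 3" "\<not> tip (pt l 0 1)"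
  shows "finger_coloring \<gamma> e (pt l 0 1) = \<gamma> (pt 0 0 1)"
proof -
  have "pull (pt l 0 1) = pt l 0 1"
    using mem_box[of "pt l 0 1"] assms(2) by (intro pull_fixes) (auto simp: base_def)
  then show ?thesis
    using assms over_line_color by (simp add: finger_coloring_def)
qed

text \<open>
  One side of a new under-point belongs to the tip, the other keeps the color of the over-strand.
\<close>

lemma colors_near_new_crossing:
  assumes "point_coloring p D \<gamma>" "new_crossing X Y"
  shows "colors_near D' (finger_coloring \<gamma> e) Y {\<gamma> (pt 0 0 1), e}"
proof (rule colors_nearI)
  let ?W = "{Z. 2 / 5 < lam Z \<and> lam Z < 1 \<and> -1 < mu Z \<and> mu Z < 1 \<and> nu Z < 3 / 2}"
  show "open ?W" by (intro open_Collect_conj open_Collect_less continuous_intros)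
  show "Y \<in> ?W" using assms(2) by (auto simp: new_crossing_def)
  show "finger_coloring \<gamma> e Z \<in> {\<gamma> (pt 0 0 1), e}" if "Z \<in> regular_part D'" "Z \<in> ?W" for Z
  proof (cases "tip Z")
    case True
    then show ?thesis by (simp add: finger_coloring_def)
  next
    case False
    have "Z \<in> D'" using that(1) by (simp add: regular_part_def)
    then have "mu Z = 0" "nu Z = 1"
      using mem_D'_box[of Z] that(2) by (auto simp: finger_def)
    then have Z: "Z = pt (lam Z) 0 1" by (intro pt_eqI) auto
    have "finger_coloring \<gamma> e (pt (lam Z) 0 1) = \<gamma> (pt 0 0 1)"
      using finger_coloring_over_line[OF assms(1), of "lam Z"] Z False that(2) by auto
    with Z show ?thesis by simp
  qed
  show "\<exists>Z\<in>regular_part D' \<inter> ball Y r. finger_coloring \<gamma> e Z = s"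
    if s: "s \<in> {\<gamma> (pt 0 0 1), e}" and r: "r > 0" for s r
  proof -
    have Y: "Y = pt (lam Y) 0 1" "lam Y = 1 / 2 \<or> lam Y = 2 / 3"
      using assms(2) by (auto simp: new_crossing_def intro!: pt_eqI)
    obtain t where t: "0 < t" "t < 1 / 10" "pt (lam Y + t) 0 1 \<in> ball Y r" "pt (lam Y - t) 0 1 \<in> ball Y r"
      using pt_shift_near[OF r, of "1 / 10" "lam Y" 1 0 0 1] Y(1) by auto
    have reg: "pt l 0 1 \<in> regular_part D'" if "l \<in> {lam Y + t, lam Y - t}" for l
      using regular_part_over_line[OF over_line_in_D'[of l]] that t(1,2) Y(2) by auto
    have in_tip: "tip (pt l 0 1) \<longleftrightarrow> l = (if lam Y = 1 / 2 then lam Y + t else lam Y - t)"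
      if "l \<in> {lam Y + t, lam Y - t}" for l
      using that t(1,2) Y(2) by (auto simp: tip_def)
    \<comment> \<open>At the first new crossing the tip is ahead, at the second one it is behind.\<close>
    define l where "l = (if (s = e) = (lam Y = 1 / 2) then lam Y + t else lam Y - t)"
    have l: "l \<in> {lam Y + t, lam Y - t}" "pt l 0 1 \<in> ball Y r" "\<bar>l\<bar> < 3"
      using t Y(2) by (auto simp: l_def)
    have "tip (pt l 0 1) \<longleftrightarrow> s = e"
      using in_tip[OF l(1)] t(1) by (auto simp: l_def)
    then have "finger_coloring \<gamma> e (pt l 0 1) = s"
      using s finger_coloring_over_line[OF assms(1) l(3), of e] by (auto simp: finger_coloring_def)
    then show ?thesis using reg[OF l(1)] l(2) by blast
  qed
qed

lemma finger_coloring_new_over: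
  assumes "point_coloring p D \<gamma>" "new_crossing X Y"
  shows "finger_coloring \<gamma> e X = \<gamma> (pt 0 1 0)"
proof -
  have "finger X" "0 < lam X" using assms(2) by (auto simp: new_crossing_def finger_def)
  then obtain Z where Z: "base Z" "push 1 Z = X" using finger_push_base by blast
  then have "Z = pt 0 (mu Z) 0" by (intro pt_eqI) (auto simp: base_def)
  then have "\<gamma> Z = \<gamma> (pt 0 1 0)"
    using under_line_color(1)[OF assms(1), of "mu Z"] Z(1) by (auto simp: base_def)
  moreover have "pull X = Z" using Z(2) pull_push by blast
  moreover have "\<not> tip X" using assms(2) by (auto simp: tip_def new_crossing_def)
  ultimately show ?thesis by (simp add: finger_coloring_def)
qed

text \<open>
  On this smaller open neighbourhood of the old crossings not only the diagram but also its coloring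
  remains the same.
\<close>

definition unchanged_region :: "(real^3) set" where
  "unchanged_region = fixed_region - {X. 1 / 2 \<le> lam X \<and> lam X \<le> 2 / 3 \<and> mu X = 0 \<and> nu X = 1}"

lemma open_unchanged_region: "open unchanged_region"
  unfolding unchanged_region_def
  by (intro open_Diff open_fixed_region closed_Collect_conj closed_Collect_le closed_Collect_eq continuous_intros)

lemma crossing_unchanged_region:
  assumes "crossing D X Y"
  shows "X \<in> unchanged_region" "Y \<in> unchanged_region"
  using crossing_fixed_region[OF assms] assms mem_box[of X] mem_box[of Y]
  unfolding unchanged_region_def crossing_iff by auto

lemma regular_part_unchanged_region:
  "regular_part D \<inter> unchanged_region = regular_part D' \<inter> unchanged_region"
proof -
  have "Z \<in> D \<longleftrightarrow> Z \<in> D'" "Z \<in> under_points D \<longleftrightarrow> Z \<in> under_points D'"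
    if "Z \<in> unchanged_region" for Z
    using that D'_fixed_region under_points_D'_iff[of Z] by (auto simp: unchanged_region_def)
  then show ?thesis unfolding regular_part_def by blast
qed

lemma finger_coloring_unchanged:
  assumes "X \<in> D" "X \<in> unchanged_region"
  shows "finger_coloring \<gamma> e X = \<gamma> X"
  using assms pull_fixes by (auto simp: unchanged_region_def mem_fixed_region finger_coloring_def tip_def)

text \<open>
  A connected subset of the new regular part either lies in the tip or, pulled back, is a connected
  subset of the old regular part.  Hence old colors may be used outside the tip, and only the two new
  crossings impose a condition on \<open>e\<close>.
\<close>

lemma point_coloring_finger:
  assumes "point_coloring p D \<gamma>" "e \<in> {0..<int p}"
    and "[2 * \<gamma> (pt 0 1 0) = \<gamma> (pt 0 0 1) + e] (mod int p)"
  shows "point_coloring p D' (finger_coloring \<gamma> e)"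
  unfolding point_coloring_def
proof (intro conjI allI impI)
  show "finger_coloring \<gamma> e ` regular_part D' \<subseteq> {0..<int p}"
    using assms(1,2) pull_regular by (auto simp: finger_coloring_def point_coloring_def)
next
  fix X Y assume "connected_component (regular_part D') X Y"
  then obtain S where S: "connected S" "S \<subseteq> regular_part D'" "X \<in> S" "Y \<in> S"
    by (auto simp: connected_component_def)
  show "finger_coloring \<gamma> e X = finger_coloring \<gamma> e Y"
  proof (cases "tip X \<or> tip Y")
    case True
    then have "tip X" "tip Y" using connected_tip S by blast+
    then show ?thesis by (simp add: finger_coloring_def)
  next
    case False
    have "connected (pull ` S)" "pull ` S \<subseteq> regular_part D"
      using S(1,2) pull_regular by (auto intro: connected_continuous_image continuous_pull)
    then have "connected_component (regular_part D) (pull X) (pull Y)"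
      unfolding connected_component_def using S(3,4) by blast
    then have "\<gamma> (pull X) = \<gamma> (pull Y)"
      using assms(1) unfolding point_coloring_def by blast
    then show ?thesis using False by (simp add: finger_coloring_def)
  qed
next
  fix X Y assume c: "crossing D' X Y"
  show "\<exists>\<alpha> \<beta>. colors_near D' (finger_coloring \<gamma> e) Y {\<alpha>, \<beta>} \<and>
      [2 * finger_coloring \<gamma> e X = \<alpha> + \<beta>] (mod int p)"
  proof (cases "crossing D X Y")
    case True
    then obtain \<alpha> \<beta> where ab: "colors_near D \<gamma> Y {\<alpha>, \<beta>}" "[2 * \<gamma> X = \<alpha> + \<beta>] (mod int p)"
      using assms(1) unfolding point_coloring_def by blast
    have "colors_near D' (finger_coloring \<gamma> e) Y {\<alpha>, \<beta>}"
    proof (rule colors_near_cong[OF ab(1) open_unchanged_region])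
      show "\<gamma> Z = finger_coloring \<gamma> e Z" if "Z \<in> regular_part D \<inter> unchanged_region" for Z
        using that finger_coloring_unchanged[of Z] by (simp add: regular_part_def)
    qed (use crossing_unchanged_region[OF True] regular_part_unchanged_region in auto)
    moreover have "finger_coloring \<gamma> e X = \<gamma> X"
      using finger_coloring_unchanged crossing_unchanged_region[OF True] True by (simp add: crossing_def)
    ultimately show ?thesis using ab(2) by auto
  next
    case False
    then have n: "new_crossing X Y" using c crossing_D'_iff by blast
    show ?thesis
      using colors_near_new_crossing[OF assms(1) n] finger_coloring_new_over[OF assms(1) n] assms(3)
      by metis
  qed
qed

text \<open>
  No color gets lost: the tip is only a part of the old arc through the over-point of the crossing.
\<close>

lemma finger_coloring_image:
  assumes "point_coloring p D \<gamma>"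
  shows "finger_coloring \<gamma> e ` regular_part D' = insert e (\<gamma> ` regular_part D)"
proof (intro equalityI subsetI)
  fix s assume "s \<in> finger_coloring \<gamma> e ` regular_part D'"
  then show "s \<in> insert e (\<gamma> ` regular_part D)"
    using pull_regular by (auto simp: finger_coloring_def)
next
  fix s assume "s \<in> insert e (\<gamma> ` regular_part D)"
  then consider "s = e" | Z where "Z \<in> regular_part D" "s = \<gamma> Z" by blast
  then show "s \<in> finger_coloring \<gamma> e ` regular_part D'"
  proof cases
    case 1
    have "pt (7 / 12) 0 1 \<in> regular_part D'"
      by (rule regular_part_over_line[OF over_line_in_D']) auto
    moreover have "finger_coloring \<gamma> e (pt (7 / 12) 0 1) = s"
      using 1 by (simp add: finger_coloring_def tip_def)
    ultimately show ?thesis by blast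
  next
    case (2 Z)
    show ?thesis
    proof (cases "mu Z = 0 \<and> nu Z = 1 \<and> \<bar>lam Z\<bar> < 3")
      case True
      then have "Z = pt (lam Z) 0 1" by (intro pt_eqI) auto
      then have "s = \<gamma> (pt 0 0 1)" using 2 True over_line_color[OF assms] by metis
      then have "finger_coloring \<gamma> e (pt 0 0 1) = s"
        using finger_coloring_over_line[OF assms, of 0 e] by (simp add: tip_def)
      moreover have "pt 0 0 1 \<in> regular_part D'"
        by (rule regular_part_over_line[OF over_line_in_D']) auto
      ultimately show ?thesis by blast
    next
      case False
      have "Z \<in> D" "Z \<notin> under_points D" using 2(1) by (auto simp: regular_part_def)
      have fixed: "push 1 Z = Z" if "push 1 Z \<in> D" "\<not> base (push 1 Z)"
        using push_fixes[OF that] pull_push by metis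
      have "push 1 Z \<notin> under_points D'"
      proof
        assume "push 1 Z \<in> under_points D'"
        then consider "push 1 Z \<in> under_points D"
          | "mu (push 1 Z) = 0 \<and> nu (push 1 Z) = 1 \<and> (lam (push 1 Z) = 1 / 2 \<or> lam (push 1 Z) = 2 / 3)"
          unfolding under_points_D'_iff by blast
        then show False
        proof cases
          case 1
          then have "push 1 Z \<in> D" "\<not> base (push 1 Z)"
            using not_crossing_base by (auto simp: under_points_def crossing_def)
          with 1 fixed \<open>Z \<notin> under_points D\<close> show False by simp
        next
          case 2
          then have "push 1 Z \<in> D" "\<not> base (push 1 Z)"
            using mem_box[of "push 1 Z"] by (auto simp: base_def)
          with 2 fixed False show False by auto
        qed
      qed
      then have "push 1 Z \<in> regular_part D'"
        using \<open>Z \<in> D\<close> by (auto simp: regular_part_def)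
      moreover have "\<not> tip (push 1 Z)"
        using fixed tip_not_base[of "push 1 Z"] False by (auto simp: tip_def)
      then have "finger_coloring \<gamma> e (push 1 Z) = s"
        using 2(2) by (simp add: finger_coloring_def)
      ultimately show ?thesis by blast
    qed
  qed
qed

lemma finger_colored_crossing:
  assumes "point_coloring p D \<gamma>"
  shows "has_colored_crossing_point p D' (finger_coloring \<gamma> e) (\<gamma> (pt 0 1 0)) (\<gamma> (pt 0 0 1)) e"
proof -
  have n: "new_crossing (pt (1 / 2) 0 2) (pt (1 / 2) 0 1)" by (simp add: new_crossing_def)
  then have "crossing D' (pt (1 / 2) 0 2) (pt (1 / 2) 0 1)" by (simp add: crossing_D'_iff)
  with colors_near_new_crossing[OF assms n] finger_coloring_new_over[OF assms n] show ?thesis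
    unfolding has_colored_crossing_point_def by (metis cong_refl)
qed

end

section \<open>Existence of coordinates at a crossing\<close>

lemma transversal_independent:
  fixes u v k :: "real^3"
  assumes "k $ 1 = 0" "k $ 2 = 0" "k $ 3 \<noteq> 0" "u $ 1 * v $ 2 \<noteq> u $ 2 * v $ 1"
    and "a *\<^sub>R u + b *\<^sub>R v + c *\<^sub>R k = 0"
  shows "a = 0 \<and> b = 0 \<and> c = 0"
proof -
  have 1: "a * u $ 1 + b * v $ 1 = 0" and 2: "a * u $ 2 + b * v $ 2 = 0"
    and 3: "a * u $ 3 + b * v $ 3 + c * k $ 3 = 0"
    using assms(1,2) arg_cong[OF assms(5), of "\<lambda>w. w $ 1"] arg_cong[OF assms(5), of "\<lambda>w. w $ 2"]
      arg_cong[OF assms(5), of "\<lambda>w. w $ 3"] by simp_all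
  have "a * (u $ 1 * v $ 2 - u $ 2 * v $ 1) = 0" "b * (u $ 1 * v $ 2 - u $ 2 * v $ 1) = 0"
    using 1 2 by algebra+
  with assms(3,4) 3 show ?thesis by simp
qed

text \<open>
  Directions of the strands come from transversality at the crossing.  The part of the diagram outside
  small balls around the two points of the crossing is compact and, since there are no triple points,
  its projection has positive distance from the crossing; so a sufficiently small scaling of the
  directions gives the required prism.
\<close>

lemma crossing_chart_exists:
  assumes "diagram D" "crossing D x y"
  shows "\<exists>u v. crossing_chart D y u v (x - y)"
proof -
  obtain u v :: "real^3" where uv: "straight_at D x u" "straight_at D y v"
    and det: "u $ 1 * v $ 2 \<noteq> u $ 2 * v $ 1"
    using assms unfolding diagram_def by blast
  define k where "k = x - y"
  have xy: "x \<in> D" "y \<in> D" "proj x = proj y" "y $ 3 < x $ 3"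
    using assms(2) by (auto simp: crossing_def)
  then have k: "k $ 1 = 0" "k $ 2 = 0" "0 < k $ 3" by (auto simp: k_def proj_def)
  obtain e1 where e1: "e1 > 0" "D \<inter> ball x e1 = range (\<lambda>t. x + t *\<^sub>R u) \<inter> ball x e1"
    using uv(1) by (auto simp: straight_at_def)
  obtain e2 where e2: "e2 > 0" "D \<inter> ball y e2 = range (\<lambda>t. y + t *\<^sub>R v) \<inter> ball y e2"
    using uv(2) by (auto simp: straight_at_def)
  define \<Delta> where "\<Delta> = u $ 1 * v $ 2 - u $ 2 * v $ 1"
  have \<Delta>: "\<Delta> \<noteq> 0" using det by (simp add: \<Delta>_def)
  \<comment> \<open>\<open>f X\<close> vanishes exactly on the vertical line through the crossing.\<close>
  define f where "f X = \<bar>(X - y) $ 1 * v $ 2 - (X - y) $ 2 * v $ 1\<bar> +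
      \<bar>u $ 1 * (X - y) $ 2 - u $ 2 * (X - y) $ 1\<bar>" for X
  define K where "K = D - (ball x e1 \<union> ball y e2)"
  have pos: "f X > 0" if "X \<in> K" for X
  proof (rule ccontr)
    assume "\<not> f X > 0"
    then have 0: "(X - y) $ 1 * v $ 2 - (X - y) $ 2 * v $ 1 = 0"
      "u $ 1 * (X - y) $ 2 - u $ 2 * (X - y) $ 1 = 0"
      unfolding f_def by linarith+
    have "\<Delta> * (X - y) $ 1 = 0" "\<Delta> * (X - y) $ 2 = 0"
      unfolding \<Delta>_def using 0 by algebra+
    then have "proj X = proj y" using \<Delta> by (simp add: proj_def)
    moreover have "X \<in> D" using that by (simp add: K_def)
    ultimately have "X = y \<or> y = x \<or> X = x"
      using assms(1) xy unfolding diagram_def by metis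
    then show False using that e1(1) e2(1) xy(4) by (auto simp: K_def)
  qed
  have "compact D" using assms(1) polygonal_compact by (auto simp: diagram_def)
  then have "compact K" unfolding K_def by (intro compact_diff open_Un open_ball)
  obtain m where m: "m > 0" "\<And>X. X \<in> K \<Longrightarrow> m \<le> f X"
  proof (cases "K = {}")
    case True
    then show thesis using that[of 1] by simp
  next
    case False
    have "continuous_on K f" unfolding f_def by (intro continuous_intros)
    then obtain X where "X \<in> K" "\<forall>Y\<in>K. f X \<le> f Y"
      using continuous_attains_inf[OF \<open>compact K\<close> False] by blast
    then show thesis using that[of "f X"] pos by blast
  qed
  \<comment> \<open>The first bound keeps the prism away from \<open>K\<close>; the others keep the two strands, within the prism, in the balls where they are straight.\<close>
  define r where "r = min (m / (6 * \<bar>\<Delta>\<bar>)) (min (e1 / (3 * (1 + norm u))) (e2 / (3 * (1 + norm v))))"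
  have nz: "0 < 1 + norm u" "0 < 1 + norm v" by (smt (verit) norm_ge_zero)+
  have "r > 0" unfolding r_def using m(1) e1(1) e2(1) \<Delta> nz by simp
  have "r \<le> m / (6 * \<bar>\<Delta>\<bar>)" "r \<le> e1 / (3 * (1 + norm u))" "r \<le> e2 / (3 * (1 + norm v))"
    by (simp_all add: r_def)
  then have r: "6 * \<bar>\<Delta>\<bar> * r \<le> m" "3 * (1 + norm u) * r \<le> e1" "3 * (1 + norm v) * r \<le> e2"
    using \<Delta> nz by (simp_all add: field_simps)
  have near: "x + (l * r) *\<^sub>R u \<in> ball x e1" "y + (l * r) *\<^sub>R v \<in> ball y e2" if "\<bar>l\<bar> < 3" for l
  proof -
    have "\<bar>l * r\<bar> < 3 * r" using that \<open>r > 0\<close> by (simp add: abs_mult)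
    then have "\<bar>l * r\<bar> * (1 + norm u) < e1" "\<bar>l * r\<bar> * (1 + norm v) < e2"
      using r(2,3) nz mult_strict_right_mono[of "\<bar>l * r\<bar>" "3 * r" "1 + norm u"]
        mult_strict_right_mono[of "\<bar>l * r\<bar>" "3 * r" "1 + norm v"] by (simp_all add: mult_ac)
    moreover have "\<bar>l * r\<bar> * norm u \<le> \<bar>l * r\<bar> * (1 + norm u)" "\<bar>l * r\<bar> * norm v \<le> \<bar>l * r\<bar> * (1 + norm v)"
      by (simp_all add: mult_left_mono)
    ultimately have "\<bar>l * r\<bar> * norm u < e1" "\<bar>l * r\<bar> * norm v < e2" by linarith+
    then show "x + (l * r) *\<^sub>R u \<in> ball x e1" "y + (l * r) *\<^sub>R v \<in> ball y e2"
      by (simp_all add: dist_norm)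
  qed
  have "crossing_chart D y (r *\<^sub>R u) (r *\<^sub>R v) k"
  proof
    show "diagram D" "k $ 1 = 0" "k $ 2 = 0" "0 < k $ 3" by fact+
    have "(r *\<^sub>R u) $ 1 * (r *\<^sub>R v) $ 2 - (r *\<^sub>R u) $ 2 * (r *\<^sub>R v) $ 1 = r\<^sup>2 * \<Delta>"
      by (simp add: \<Delta>_def power2_eq_square algebra_simps)
    then show "(r *\<^sub>R u) $ 1 * (r *\<^sub>R v) $ 2 \<noteq> (r *\<^sub>R u) $ 2 * (r *\<^sub>R v) $ 1"
      using \<Delta> \<open>r > 0\<close> by (metis mult_eq_0_iff power_not_zero right_minus_eq less_irrefl)
    fix l m' n :: real
    assume l: "\<bar>l\<bar> < 3" and m': "\<bar>m'\<bar> < 3"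
    define X where "X = y + l *\<^sub>R r *\<^sub>R u + m' *\<^sub>R r *\<^sub>R v + n *\<^sub>R k"
    have "X \<in> D \<longleftrightarrow> m' = 0 \<and> n = 1 \<or> l = 0 \<and> n = 0"
    proof
      assume "X \<in> D"
      have "(X - y) $ 1 * v $ 2 - (X - y) $ 2 * v $ 1 = l * r * \<Delta>"
        "u $ 1 * (X - y) $ 2 - u $ 2 * (X - y) $ 1 = m' * r * \<Delta>"
        using k by (simp_all add: X_def \<Delta>_def algebra_simps)
      then have "f X = (\<bar>l\<bar> + \<bar>m'\<bar>) * (r * \<bar>\<Delta>\<bar>)"
        using \<open>r > 0\<close> by (simp add: f_def abs_mult algebra_simps)
      also have "\<dots> < 6 * (r * \<bar>\<Delta>\<bar>)"
        using l m' \<open>r > 0\<close> \<Delta> by (intro mult_strict_right_mono) auto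
      also have "\<dots> \<le> m" using r(1) by (simp add: mult_ac)
      finally have "X \<notin> K" using m(2)[of X] by force
      with \<open>X \<in> D\<close> have "X \<in> D \<inter> ball x e1 \<or> X \<in> D \<inter> ball y e2" by (auto simp: K_def)
      then show "m' = 0 \<and> n = 1 \<or> l = 0 \<and> n = 0"
      proof
        assume "X \<in> D \<inter> ball x e1"
        then obtain t where "X = x + t *\<^sub>R u" using e1(2) by blast
        then have "(l * r - t) *\<^sub>R u + (m' * r) *\<^sub>R v + (n - 1) *\<^sub>R k = 0"
          by (simp add: X_def k_def algebra_simps)
        then have "m' * r = 0 \<and> n - 1 = 0"
          using transversal_independent[OF k(1,2) _ det] k(3) by (metis less_irrefl)
        then show ?thesis using \<open>r > 0\<close> by simp
      next
        assume "X \<in> D \<inter> ball y e2"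
        then obtain t where "X = y + t *\<^sub>R v" using e2(2) by blast
        then have "(l * r) *\<^sub>R u + (m' * r - t) *\<^sub>R v + n *\<^sub>R k = 0"
          by (simp add: X_def algebra_simps)
        then have "l * r = 0 \<and> n = 0"
          using transversal_independent[OF k(1,2) _ det] k(3) by (metis less_irrefl)
        then show ?thesis using \<open>r > 0\<close> by simp
      qed
    next
      assume "m' = 0 \<and> n = 1 \<or> l = 0 \<and> n = 0"
      then have "X = x + (l * r) *\<^sub>R u \<or> X = y + (m' * r) *\<^sub>R v"
        by (auto simp: X_def k_def)
      then show "X \<in> D"
        using near(1)[OF l] near(2)[OF m'] e1(2) e2(2) by blast
    qed
    then show "y + l *\<^sub>R r *\<^sub>R u + m' *\<^sub>R r *\<^sub>R v + n *\<^sub>R k \<in> D \<longleftrightarrow> m' = 0 \<and> n = 1 \<or> l = 0 \<and> n = 0"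
      unfolding X_def .
  qed
  then show ?thesis unfolding k_def by blast
qed

text \<open>
  Reversing \<open>v\<close> interchanges the two sides of the under-strand, so that the finger can be pulled from
  either side.
\<close>

lemma crossing_chart_flip:
  assumes "crossing_chart D orig u v k"
  shows "crossing_chart D orig u (- v) k"
proof -
  interpret crossing_chart D orig u v k by fact
  show ?thesis
  proof
    show "diagram D" "k $ 1 = 0" "k $ 2 = 0" "0 < k $ 3" by (fact diagram vertical)+
    show "u $ 1 * (- v) $ 2 \<noteq> u $ 2 * (- v) $ 1" using transversal by simp
    show "orig + l *\<^sub>R u + m *\<^sub>R - v + n *\<^sub>R k \<in> D \<longleftrightarrow> m = 0 \<and> n = 1 \<or> l = 0 \<and> n = 0"
      if "\<bar>l\<bar> < 3" "\<bar>m\<bar> < 3" for l m n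
      using box[of l "- m" n] that by simp
  qed
qed

section \<open>Filling the spectrum\<close>

lemma new_color_by_finger:
  assumes "diagram D" "point_coloring p D \<gamma>" "has_colored_crossing_point p D \<gamma> b a d" "p > 0"
  shows "\<exists>D' \<gamma>'. diagram D' \<and> ambient_isotopic D D' \<and> point_coloring p D' \<gamma>' \<and>
     \<gamma>' ` regular_part D' = insert ((2 * d - b) mod int p) (\<gamma> ` regular_part D) \<and>
     has_colored_crossing_point p D' \<gamma>' d b (2 * d - b)"
proof -
  obtain x y \<alpha> \<beta> where c: "crossing D x y" "colors_near D \<gamma> y {\<alpha>, \<beta>}"
    "[\<gamma> x = b] (mod int p)" "[\<beta> = d] (mod int p)"
    using assms(3) unfolding has_colored_crossing_point_def by blast
  obtain u v where chart: "crossing_chart D y u v (x - y)"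
    using crossing_chart_exists[OF assms(1) c(1)] by blast
  have "\<exists>v. crossing_chart D y u v (x - y) \<and> \<gamma> (y + v) = \<beta>"
  proof -
    interpret crossing_chart D y u v "x - y" by fact
    have "{\<alpha>, \<beta>} = {\<gamma> (y + v), \<gamma> (y + - v)}"
      using colors_near_unique[OF c(2)] colors_near_center[OF assms(2)] by (simp add: pt_def)
    then have "\<beta> = \<gamma> (y + v) \<or> \<beta> = \<gamma> (y + - v)" by blast
    then show ?thesis using chart crossing_chart_flip[OF chart] by metis
  qed
  then obtain v where chart: "crossing_chart D y u v (x - y)" and \<beta>: "\<gamma> (y + v) = \<beta>" by blast
  interpret crossing_chart D y u v "x - y" by fact
  define e where "e = (2 * d - b) mod int p"
  have e: "[e = 2 * d - b] (mod int p)" by (simp add: e_def cong_def)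
  have pts: "pt 0 1 0 = y + v" "pt 0 0 1 = x" by (simp_all add: pt_def)
  have "[2 * \<beta> = \<gamma> x + e] (mod int p)"
  proof -
    have "[\<gamma> x + e = b + (2 * d - b)] (mod int p)" using c(3) e by (rule cong_add)
    moreover have "[2 * \<beta> = 2 * d] (mod int p)" using c(4) by (rule cong_scalar_left)
    ultimately show ?thesis using cong_sym cong_trans by fastforce
  qed
  then have pc: "point_coloring p D' (finger_coloring \<gamma> e)"
    using assms(4) by (intro point_coloring_finger assms(2)) (auto simp: pts \<beta> e_def)
  have "has_colored_crossing_point p D' (finger_coloring \<gamma> e) \<beta> (\<gamma> x) e"
    using finger_colored_crossing[OF assms(2), of e] by (simp add: pts \<beta>)
  then have "has_colored_crossing_point p D' (finger_coloring \<gamma> e) d b (2 * d - b)"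
    unfolding has_colored_crossing_point_def using c(3,4) e cong_trans by meson
  with pc diagram_D' ambient_isotopic_push finger_coloring_image[OF assms(2), of e] show ?thesis
    unfolding e_def by blast
qed

text \<open>
  The offset \<open>3\<close> is due to the three terms \<open>a\<close>, \<open>b\<close>, \<open>2 b - a\<close> of the progression that the initial
  crossing already shows.
\<close>

lemma colors_in_progression:
  assumes "diagram D" "point_coloring p D \<gamma>" "has_colored_crossing_point p D \<gamma> b a (2 * b - a)" "p > 0"
  shows "\<exists>D' \<gamma>'. diagram D' \<and> ambient_isotopic D D' \<and> point_coloring p D' \<gamma>' \<and>
     \<gamma>' ` regular_part D' = \<gamma> ` regular_part D \<union> (\<lambda>i. (a + int (i + 3) * (b - a)) mod int p) ` {..<j} \<and>
     has_colored_crossing_point p D' \<gamma>' (a + int (j + 1) * (b - a)) (a + int j * (b - a))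
       (a + int (j + 2) * (b - a))"
proof (induction j)
  case 0
  have "a + int (0 + 1) * (b - a) = b" "a + int (0 + 2) * (b - a) = 2 * b - a" by simp_all
  then show ?case using assms ambient_isotopic_refl by fastforce
next
  case (Suc j)
  then obtain D1 \<gamma>1 where 1: "diagram D1" "ambient_isotopic D D1" "point_coloring p D1 \<gamma>1"
    "\<gamma>1 ` regular_part D1 = \<gamma> ` regular_part D \<union> (\<lambda>i. (a + int (i + 3) * (b - a)) mod int p) ` {..<j}"
    "has_colored_crossing_point p D1 \<gamma>1 (a + int (j + 1) * (b - a)) (a + int j * (b - a))
       (a + int (j + 2) * (b - a))"
    by blast
  have new: "2 * (a + int (j + 2) * (b - a)) - (a + int (j + 1) * (b - a)) = a + int (j + 3) * (b - a)"
    by (simp add: algebra_simps)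
  obtain D2 \<gamma>2 where 2: "diagram D2" "ambient_isotopic D1 D2" "point_coloring p D2 \<gamma>2"
    "\<gamma>2 ` regular_part D2 = insert ((a + int (j + 3) * (b - a)) mod int p) (\<gamma>1 ` regular_part D1)"
    "has_colored_crossing_point p D2 \<gamma>2 (a + int (j + 2) * (b - a)) (a + int (j + 1) * (b - a))
       (a + int (j + 3) * (b - a))"
    using new_color_by_finger[OF 1(1,3,5) assms(4)] unfolding new by blast
  have "\<gamma>2 ` regular_part D2 = \<gamma> ` regular_part D \<union> (\<lambda>i. (a + int (i + 3) * (b - a)) mod int p) ` {..<Suc j}"
    unfolding 2(4) 1(4) by (auto simp: lessThan_Suc)
  moreover have "ambient_isotopic D D2" using 1(2) 2(2) by (rule ambient_isotopic_trans)
  moreover have "Suc j + 1 = j + 2" "Suc j + 2 = j + 3" "Suc j = j + 1" by simp_all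
  ultimately show ?case using 2(1,3,5) by metis
qed

text \<open>
  The color \<open>z\<close> appears at the index \<open>k (z - a) - 3\<close>, reduced modulo \<open>p\<close>.
\<close>

lemma progression_all_residues:
  fixes a s k :: int
  assumes "p > 0" "[s * k = 1] (mod int p)"
  shows "{0..<int p} \<subseteq> (\<lambda>i. (a + int (i + 3) * s) mod int p) ` {..<p}"
proof
  fix z assume z: "z \<in> {0..<int p}"
  define i where "i = nat ((k * (z - a) - 3) mod int p)"
  have i: "int i = (k * (z - a) - 3) mod int p"
    using assms(1) by (simp add: i_def)
  have "i < p" using i assms(1) by (metis of_nat_0_less_iff of_nat_less_iff pos_mod_bound)
  have "[int i + 3 = (k * (z - a) - 3) + 3] (mod int p)"
    unfolding i by (intro cong_add cong_refl) (simp add: cong_def)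
  then have "[(int i + 3) * s = k * (z - a) * s] (mod int p)"
    using cong_scalar_right by fastforce
  moreover have "[s * k * (z - a) = 1 * (z - a)] (mod int p)"
    using assms(2) by (rule cong_scalar_right)
  ultimately have "[(int i + 3) * s = z - a] (mod int p)"
    using cong_trans by (fastforce simp: mult_ac)
  then have "[a + (int i + 3) * s = a + (z - a)] (mod int p)"
    by (intro cong_add cong_refl)
  then have "(a + int (i + 3) * s) mod int p = z"
    using z by (simp add: cong_def)
  then show "z \<in> (\<lambda>i. (a + int (i + 3) * s) mod int p) ` {..<p}"
    using \<open>i < p\<close> by blast
qed

lemma num_colors_le:
  assumes "coloring p D c"
  shows "num_colors D c \<le> p"
proof -
  have "card (c ` arcs D) \<le> card {0..<int p}"
    using assms by (intro card_mono) (auto simp: coloring_def)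
  then show ?thesis by (simp add: num_colors_def)
qed

text \<open>
  A discrete intermediate value argument along the finger moves.
\<close>

lemma all_numbers_of_colors:
  assumes "nontrivial_coloring_of p L D c" "has_colored_crossing p D c b a (2 * b - a)"
    and "p > 0" "[(b - a) * k = 1] (mod int p)" "num_colors D c \<le> n" "n \<le> p"
  shows "\<exists>D' c'. nontrivial_coloring_of p L D' c' \<and> num_colors D' c' = n"
proof -
  have D: "diagram D" "ambient_isotopic L D" "coloring p D c" "num_colors D c > 1"
    using assms(1) by (auto simp: nontrivial_coloring_of_def diagram_of_def)
  define \<gamma> where "\<gamma> x = c (connected_component_set (regular_part D) x)" for x
  have ac: "arc_colors D \<gamma> c"
    unfolding \<gamma>_def by (rule arc_colors_of_coloring)
  have pc: "point_coloring p D \<gamma>" using coloring_iff_point_coloring[OF D(1) ac] D(3) by blast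
  have hc: "has_colored_crossing_point p D \<gamma> b a (2 * b - a)"
    by (rule has_colored_crossing_imp_point[OF D(1) ac assms(2)])
  define S where "S j = \<gamma> ` regular_part D \<union> (\<lambda>i. (a + int (i + 3) * (b - a)) mod int p) ` {..<j}" for j
  have fin0: "\<gamma> ` regular_part D \<subseteq> {0..<int p}" using pc by (simp add: point_coloring_def)
  have fin: "finite (S j)" for j
    unfolding S_def using finite_subset[OF fin0] by simp
  have "S (Suc j) = insert ((a + int (j + 3) * (b - a)) mod int p) (S j)" for j
    by (auto simp: S_def lessThan_Suc)
  then have "\<bar>int (card (S (j + 1))) - int (card (S j))\<bar> \<le> 1" for j
    using fin[of j] by (simp add: card_insert_if)
  moreover have "int (card (S 0)) \<le> int n"
    using assms(5) arc_colors_range[OF ac] by (simp add: S_def num_colors_def)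
  moreover have "int n \<le> int (card (S p))"
  proof -
    have "card {0..<int p} \<le> card (S p)"
      using progression_all_residues[OF assms(3,4), of a] fin by (intro card_mono) (auto simp: S_def)
    then show ?thesis using assms(6) by simp
  qed
  ultimately obtain j where j: "int (card (S j)) = int n"
    using nat0_intermed_int_val[of p "\<lambda>j. int (card (S j))" "int n"] by blast
  obtain D' \<gamma>' where D': "diagram D'" "ambient_isotopic D D'" "point_coloring p D' \<gamma>'"
    "\<gamma>' ` regular_part D' = S j"
    using colors_in_progression[OF D(1) pc hc assms(3), of j] unfolding S_def by blast
  define c' where "c' U = \<gamma>' (SOME x. x \<in> U)" for U
  have ac': "arc_colors D' \<gamma>' c'"
    unfolding c'_def by (rule arc_colors_of_point_coloring[OF D'(3)])
  have "coloring p D' c'" using coloring_iff_point_coloring[OF D'(1) ac'] D'(3) by blast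
  moreover have "num_colors D' c' = n"
    using arc_colors_range[OF ac'] D'(4) j by (simp add: num_colors_def)
  moreover have "diagram_of D' L"
    using D'(1) ambient_isotopic_trans[OF D(2) D'(2)] by (simp add: diagram_of_def)
  moreover have "n > 1" using D(4) assms(5) by simp
  ultimately show ?thesis unfolding nontrivial_coloring_of_def by blast
qed

lemma Spec_eq_interval:
  assumes "minimal_coloring_of p L D c" "has_colored_crossing p D c b a (2 * b - a)"
    and "p > 0" "[(b - a) * k = 1] (mod int p)"
  shows "Spec p L = {mincol p L..maxcol p L}"
proof -
  define P where "P n \<longleftrightarrow> (\<exists>D c. nontrivial_coloring_of p L D c \<and> num_colors D c = n)" for n
  have le: "n \<le> p" if "P n" for n
    using that num_colors_le by (auto simp: P_def nontrivial_coloring_of_def)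
  have pos: "n > 0" if "P n" for n
    using that by (auto simp: P_def nontrivial_coloring_of_def)
  have min: "mincol p L = (LEAST n. P n)" and max: "maxcol p L = (GREATEST n. P n)"
    and spec: "Spec p L = {n. n > 0 \<and> P n}"
    by (simp_all add: P_def mincol_def maxcol_def Spec_def)
  have m: "nontrivial_coloring_of p L D c" "num_colors D c = mincol p L"
    using assms(1) by (auto simp: minimal_coloring_of_def)
  then have "P (mincol p L)" by (auto simp: P_def)
  then have "P (maxcol p L)" unfolding max using le by (rule GreatestI_nat)
  have "P n" if "mincol p L \<le> n" "n \<le> maxcol p L" for n
    unfolding P_def using that m(2) le[OF \<open>P (maxcol p L)\<close>]
    by (intro all_numbers_of_colors[OF m(1) assms(2-4)]) auto
  moreover have "mincol p L \<le> n" if "P n" for n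
    unfolding min using that by (rule Least_le)
  moreover have "n \<le> maxcol p L" if "P n" for n
    unfolding max using that le by (rule Greatest_le_nat)
  ultimately have "n > 0 \<and> P n \<longleftrightarrow> mincol p L \<le> n \<and> n \<le> maxcol p L" for n
    using pos by blast
  then show ?thesis unfolding spec set_eq_iff by simp
qed

theorem corollary1p4:
  fixes p :: nat and L :: "(real^3) set"
  assumes "(prime p \<and> odd p) \<or> (p > 1 \<and> \<not> prime p)"
    and "is_link L" and "\<not> split_link L"
    and "admits_nontrivial_colorings p L"
  shows "((\<exists>D c. minimal_coloring_of p L D c \<and> has_colored_crossing p D c 1 0 2) \<longrightarrow>
            Spec p L = {mincol p L..maxcol p L})
       \<and> (\<forall>a b :: int.
            (\<exists>k. [(b - a) * k = 1] (mod int p)) \<and>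
            (\<exists>D c. minimal_coloring_of p L D c \<and> has_colored_crossing p D c b a (2 * b - a)) \<longrightarrow>
            Spec p L = {mincol p L..maxcol p L})"
proof -
  have "p > 0" using assms(1)
    by (elim disjE) (simp_all add: prime_gt_0_nat)
  have "Spec p L = {mincol p L..maxcol p L}"
    if "minimal_coloring_of p L D c" "has_colored_crossing p D c b a (2 * b - a)"
      "[(b - a) * k = 1] (mod int p)" for D c a b k
    using Spec_eq_interval that \<open>p > 0\<close> by blast
  note interval = this
  show ?thesis
  proof (intro conjI impI allI)
    assume "\<exists>D c. minimal_coloring_of p L D c \<and> has_colored_crossing p D c 1 0 2"
    then show "Spec p L = {mincol p L..maxcol p L}"
      using interval[of _ _ 1 0 1] by auto
  next
    fix a b :: int
    assume "(\<exists>k. [(b - a) * k = 1] (mod int p)) \<and>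
      (\<exists>D c. minimal_coloring_of p L D c \<and> has_colored_crossing p D c b a (2 * b - a))"
    then show "Spec p L = {mincol p L..maxcol p L}"
      using interval by blast
  qed
qed

end
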